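(* (1) The size of every mismatching dissection of a convex $3$-polytope with $n$ vertices is at least $n-2$. (2) The size of every dissection (mismatching or not) of a convex $3$-polytope with $n$ vertices is at most $\binom{n-2}{2}$.
   Context: A dissection of a convex $3$-polytope $P$ is a set of tetrahedra whose vertices are among the vertices of $P$, such that no two of them have an interior point in common and their union is $P$. A dissection is a triangulation if any two of its tetrahedra intersect in a common face (possibly empty); it is mismatching if it is not a triangulation. The size of a dissection is its number of tetrahedra. *)

theory Defs
  imports "HOL-Analysis.Analysis"
begin

text \<open>The ambient space is \<open>\<real>\<^sup>3\<close>, so full-dimensional tetrahedra have nonempty topological interior.\<close>

definition convex_3_polytope :: "(real^3) set \<Rightarrow> bool" where
  "convex_3_polytope P \<longleftrightarrow> polytope P \<and> aff_dim P = 3"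

definition vertices :: "(real^3) set \<Rightarrow> (real^3) set" where
  "vertices P = {v. v extreme_point_of P}"

definition dissection :: "(real^3) set \<Rightarrow> (real^3) set set \<Rightarrow> bool" where
  "dissection P \<D> \<longleftrightarrow>
     (\<forall>T\<in>\<D>. 3 simplex T \<and> vertices T \<subseteq> vertices P) \<and>
     (\<forall>S\<in>\<D>. \<forall>T\<in>\<D>. S \<noteq> T \<longrightarrow> interior S \<inter> interior T = {}) \<and>
     \<Union>\<D> = P"

text \<open>Finiteness is not part of the definition since it follows from the vertex condition;
  in particular \<^const>\<open>card\<close> is the genuine size of a dissection.\<close>

lemma finite_dissection:
  assumes "polytope P" "dissection P \<D>"
  shows "finite \<D>"
proof -
  have "finite (vertices P)"
    unfolding vertices_def
    using assms(1) finite_polyhedron_extreme_points polytope_imp_polyhedron by blast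
  moreover have "\<D> \<subseteq> (\<lambda>C. convex hull C) ` Pow (vertices P)"
  proof
    fix T assume T: "T \<in> \<D>"
    then have "3 simplex T" and sub: "vertices T \<subseteq> vertices P"
      using assms(2) by (auto simp: dissection_def)
    then obtain C where C: "\<not> affine_dependent C" "T = convex hull C"
      by (auto simp: simplex_def)
    then have "vertices T = C"
      by (simp add: vertices_def extreme_point_of_convex_hull_affine_independent)
    then show "T \<in> (\<lambda>C. convex hull C) ` Pow (vertices P)"
      using C sub by blast
  qed
  ultimately show ?thesis
    by (meson finite_Pow_iff finite_imageI finite_subset)
qed

definition mismatching_dissection :: "(real^3) set \<Rightarrow> (real^3) set set \<Rightarrow> bool" where
  "mismatching_dissection P \<D> \<longleftrightarrow> dissection P \<D> \<and> \<not> triangulation \<D>"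

text \<open>For a dissection, the library's \<^const>\<open>triangulation\<close> says exactly that any two members
  meet in a common (possibly empty) face.\<close>

lemma triangulation_dissection_iff:
  assumes "polytope P" "dissection P \<D>"
  shows "triangulation \<D> \<longleftrightarrow>
    (\<forall>S\<in>\<D>. \<forall>T\<in>\<D>. (S \<inter> T) face_of S \<and> (S \<inter> T) face_of T)"
proof -
  have "\<forall>T\<in>\<D>. \<exists>n. n simplex T"
    using assms(2) by (auto simp: dissection_def)
  then show ?thesis
    unfolding triangulation_def using finite_dissection[OF assms] by (metis Int_commute)
qed

end

(* Fix a generic interior point p of P. Inside a single tetrahedron T, count an edge if p lies on the
   inner side of both facets of T through that edge, or on the outer side of both, and count a vertex
   in the same way using its three facets; the number of counted edges exceeds the number of counted
   vertices by exactly 2. For every vertex v of P exactly one tetrahedron of the dissection counts v,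
   namely the one entered when moving from v towards p. Hence 2 f + n is the total number of pairs
   (edge, tetrahedron) counted, with f the size of the dissection. As tetrahedra have disjoint
   interiors, every segment between vertices of P is counted at most once on the inner and once on
   the outer side, and segments in the boundary of P never on the outer side.

   The facets of tetrahedra lying in the boundary of P are at least 2n - 4 triangles: sweeping by a
   generic linear functional, every vertex except the lowest and highest is the middle vertex of at
   least two of them. Since an edge lies in at most two such triangles, they have at least 3n - 6
   edges, and each of these is counted exactly once. This gives
   3n - 6 <= 2 f + n <= 2 (n choose 2) - (3n - 6), where the second inequality is (2).
   If some tetrahedron has an edge through the interior of P, choosing p inside that tetrahedron
   improves the first inequality by one, which by parity gives (1). A dissection without such an edge
   is a triangulation. *)

theory Submission
  imports Defs
begin

subsection \<open>Barycentric coordinates\<close>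

definition affine_basis :: "'a::euclidean_space set \<Rightarrow> bool" where
  "affine_basis V \<longleftrightarrow> \<not> affine_dependent V \<and> card V = Suc DIM('a)"

text \<open>The choice leaves the values outside \<open>V\<close> open. On an affine basis
  \<open>V\<close> they are the unique affine coordinates, hence the recurring assumption that the
  index lies in \<open>V\<close>.\<close>

definition bary :: "'a::euclidean_space set \<Rightarrow> 'a \<Rightarrow> 'a \<Rightarrow> real" where
  "bary V x = (SOME u. sum u V = 1 \<and> (\<Sum>v\<in>V. u v *\<^sub>R v) = x)"

lemma affine_basis_finite: "affine_basis V \<Longrightarrow> finite V"
  by (simp add: affine_basis_def aff_independent_finite)

lemma affine_basis_hull:
  fixes V :: "'a::euclidean_space set"
  assumes "affine_basis V"
  shows "affine hull V = UNIV"
proof -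
  have "aff_dim V = DIM('a)"
    using assms by (auto simp: affine_basis_def affine_independent_iff_card)
  then show ?thesis
    by (simp only: aff_dim_eq_full)
qed

lemma bary:
  assumes "affine_basis V"
  shows sum_bary: "sum (bary V x) V = 1"
    and bary_repr: "(\<Sum>v\<in>V. bary V x v *\<^sub>R v) = x"
proof -
  have "x \<in> affine hull V"
    by (simp add: affine_basis_hull[OF assms])
  then have "\<exists>u. sum u V = 1 \<and> (\<Sum>v\<in>V. u v *\<^sub>R v) = x"
    by (simp add: affine_hull_finite[OF affine_basis_finite[OF assms]])
  then have "sum (bary V x) V = 1 \<and> (\<Sum>v\<in>V. bary V x v *\<^sub>R v) = x"
    unfolding bary_def by (rule someI_ex)
  then show "sum (bary V x) V = 1" "(\<Sum>v\<in>V. bary V x v *\<^sub>R v) = x"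
    by auto
qed

lemma bary_unique:
  assumes "affine_basis V" "sum u V = 1" "(\<Sum>v\<in>V. u v *\<^sub>R v) = x" "v \<in> V"
  shows "bary V x v = u v"
proof (rule ccontr)
  assume "bary V x v \<noteq> u v"
  moreover have "sum (\<lambda>v. bary V x v - u v) V = 0"
    using assms sum_bary[OF assms(1)] by (simp add: sum_subtractf)
  moreover have "(\<Sum>v\<in>V. (bary V x v - u v) *\<^sub>R v) = 0"
    using assms bary_repr[OF assms(1)] by (simp add: scaleR_left_diff_distrib sum_subtractf)
  ultimately have "affine_dependent V"
    using assms(4) by (force simp: affine_dependent_explicit_finite[OF affine_basis_finite[OF assms(1)]]
      intro!: exI[of _ "\<lambda>v. bary V x v - u v"])
  then show False
    using assms(1) by (simp add: affine_basis_def)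
qed

text \<open>Each coordinate is an affine function of the point. The weights may be negative, so
  points beyond a segment are covered too.\<close>

lemma bary_sum:
  assumes V: "affine_basis V" and "sum c I = 1" "v \<in> V"
  shows "bary V (\<Sum>i\<in>I. c i *\<^sub>R f i) v = (\<Sum>i\<in>I. c i * bary V (f i) v)"
proof (rule bary_unique[OF V _ _ \<open>v \<in> V\<close>])
  show "(\<Sum>v\<in>V. \<Sum>i\<in>I. c i * bary V (f i) v) = 1"
    by (subst sum.swap) (simp add: sum_distrib_left[symmetric] sum_bary[OF V] assms(2))
  have "(\<Sum>v\<in>V. (\<Sum>i\<in>I. c i * bary V (f i) v) *\<^sub>R v) = (\<Sum>i\<in>I. c i *\<^sub>R (\<Sum>v\<in>V. bary V (f i) v *\<^sub>R v))"
    by (simp add: scaleR_sum_left scaleR_sum_right) (rule sum.swap)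
  then show "(\<Sum>v\<in>V. (\<Sum>i\<in>I. c i * bary V (f i) v) *\<^sub>R v) = (\<Sum>i\<in>I. c i *\<^sub>R f i)"
    by (simp add: bary_repr[OF V])
qed

lemma bary_affine:
  assumes "affine_basis V" "s + t = 1" "v \<in> V"
  shows "bary V (s *\<^sub>R x + t *\<^sub>R y) v = s * bary V x v + t * bary V y v"
  using bary_sum[OF assms(1) _ assms(3), of "\<lambda>b. if b then s else t" UNIV "\<lambda>b. if b then x else y"] assms(2)
  by (simp add: UNIV_bool add.commute)

lemma bary_affine3:
  assumes "affine_basis V" "r + s + t = 1" "v \<in> V"
  shows "bary V (r *\<^sub>R x + s *\<^sub>R y + t *\<^sub>R z) v = r * bary V x v + s * bary V y v + t * bary V z v"
  using bary_sum[OF assms(1) _ assms(3), of "\<lambda>i. if i = 0 then r else if i = Suc 0 then s else t" "{..<3}"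
      "\<lambda>i. if i = 0 then x else if i = Suc 0 then y else z"] assms(2)
  by (simp add: numeral_3_eq_3 lessThan_Suc ac_simps)

lemma bary_vertex:
  assumes "affine_basis V" "v \<in> V" "w \<in> V"
  shows "bary V w v = (if v = w then 1 else 0)"
proof (rule bary_unique[OF assms(1) _ _ assms(2)])
  show "(\<Sum>v\<in>V. if v = w then 1 else (0::real)) = 1"
    using assms by (simp add: affine_basis_finite)
  have "(\<Sum>v\<in>V. (if v = w then 1 else 0) *\<^sub>R v) = (\<Sum>v\<in>V. if v = w then v else 0)"
    by (rule sum.cong) auto
  then show "(\<Sum>v\<in>V. (if v = w then 1 else 0) *\<^sub>R v) = w"
    using assms by (simp add: affine_basis_finite)
qed

lemma inner_bary:
  assumes "affine_basis V"
  shows "a \<bullet> x = (\<Sum>v\<in>V. bary V x v * (a \<bullet> v))"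
  by (subst bary_repr[OF assms, of x, symmetric]) (simp add: inner_sum_right)

text \<open>Since the coordinates sum to 1, \<open>b\<close> can be moved inside the sum. If the
  functional takes the value \<open>b\<close> at most vertices, only the coordinates of the others
  remain.\<close>

lemma inner_bary_diff:
  assumes "affine_basis V"
  shows "a \<bullet> x - b = (\<Sum>v\<in>V. bary V x v * (a \<bullet> v - b))"
  by (simp add: right_diff_distrib sum_subtractf inner_bary[OF assms, of a x]
    sum_distrib_right[symmetric] sum_bary[OF assms])

lemma inner_not_const:
  assumes "affine_basis V" "a \<noteq> 0"
  shows "\<exists>v\<in>V. a \<bullet> v \<noteq> b"
proof (rule ccontr)
  assume "\<not> ?thesis"
  then have "a \<bullet> x - b = 0" for x
    by (simp add: inner_bary_diff[OF assms(1), of a x b])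
  from this[of 0] this[of a] show False
    using assms(2) by auto
qed

lemma convex_hull_bary_iff:
  assumes V: "affine_basis V" and "U \<subseteq> V"
  shows "x \<in> convex hull U \<longleftrightarrow> (\<forall>v\<in>V. 0 \<le> bary V x v) \<and> (\<forall>v\<in>V-U. bary V x v = 0)"
proof
  have fin: "finite V" "finite U"
    using affine_basis_finite[OF V] assms(2) finite_subset by auto
  {
    assume "x \<in> convex hull U"
    then obtain u where u: "\<forall>v\<in>U. 0 \<le> u v" "sum u U = 1" "(\<Sum>v\<in>U. u v *\<^sub>R v) = x"
      by (auto simp: convex_hull_finite[OF fin(2)])
    define w where "w = (\<lambda>v. if v \<in> U then u v else 0)"
    have "bary V x v = w v" if "v \<in> V" for v
    proof (rule bary_unique[OF V _ _ that])
      show "sum w V = 1"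
        using u(2) assms(2) fin by (simp add: w_def sum.If_cases Int_absorb1)
      have "(\<Sum>v\<in>V. w v *\<^sub>R v) = (\<Sum>v\<in>U. w v *\<^sub>R v)"
        using assms(2) fin by (intro sum.mono_neutral_right) (auto simp: w_def)
      then show "(\<Sum>v\<in>V. w v *\<^sub>R v) = x"
        using u(3) by (simp add: w_def cong: sum.cong)
    qed
    then show "(\<forall>v\<in>V. 0 \<le> bary V x v) \<and> (\<forall>v\<in>V-U. bary V x v = 0)"
      using u(1) by (auto simp: w_def)
  next
    assume *: "(\<forall>v\<in>V. 0 \<le> bary V x v) \<and> (\<forall>v\<in>V-U. bary V x v = 0)"
    have "sum (bary V x) U = sum (bary V x) V"
      using * assms(2) fin by (intro sum.mono_neutral_left) auto
    moreover have "(\<Sum>v\<in>U. bary V x v *\<^sub>R v) = (\<Sum>v\<in>V. bary V x v *\<^sub>R v)"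
      using * assms(2) fin by (intro sum.mono_neutral_left) auto
    ultimately show "x \<in> convex hull U"
      using * assms(2) by (auto simp: convex_hull_finite[OF fin(2)] bary[OF V] intro!: exI[of _ "bary V x"])
  }
qed

lemma convex_hull_bary: "affine_basis V \<Longrightarrow> x \<in> convex hull V \<longleftrightarrow> (\<forall>v\<in>V. 0 \<le> bary V x v)"
  using convex_hull_bary_iff[of V V] by simp

lemma interior_convex_hull_bary:
  assumes V: "affine_basis V"
  shows "x \<in> interior (convex hull V) \<longleftrightarrow> (\<forall>v\<in>V. 0 < bary V x v)"
proof -
  have "interior (convex hull V) = {y. \<exists>u. (\<forall>x \<in> V. 0 < u x) \<and> sum u V = 1 \<and> (\<Sum>x\<in>V. u x *\<^sub>R x) = y}"
    using V by (simp add: affine_basis_def interior_convex_hull_explicit_minimal)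
  moreover have "\<forall>v\<in>V. 0 < bary V x v" if "\<forall>v\<in>V. 0 < u v" "sum u V = 1" "(\<Sum>v\<in>V. u v *\<^sub>R v) = x" for u
    using that bary_unique[OF V that(2,3)] by simp
  moreover have "sum (bary V x) V = 1" "(\<Sum>v\<in>V. bary V x v *\<^sub>R v) = x"
    by (rule bary[OF V])+
  ultimately show ?thesis
    by blast
qed

lemma interior_convex_hull_affine_basis_nonempty:
  fixes V :: "'a::euclidean_space set"
  assumes V: "affine_basis V"
  shows "interior (convex hull V) \<noteq> {}"
proof -
  define u where "u = (\<lambda>v::'a. 1 / real (card V))"
  have "card V > 0"
    using V by (simp add: affine_basis_def)
  then have "sum u V = 1" and pos: "\<And>v. u v > 0"
    by (auto simp: u_def)
  then have "bary V (\<Sum>v\<in>V. u v *\<^sub>R v) v = u v" if "v \<in> V" for v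
    using bary_unique[OF V _ refl that] by blast
  then have "(\<Sum>v\<in>V. u v *\<^sub>R v) \<in> interior (convex hull V)"
    using pos by (simp add: interior_convex_hull_bary[OF V])
  then show ?thesis
    by blast
qed

lemma bary_zero_subset_affine_hull:
  assumes V: "affine_basis V" and "v \<in> V"
  shows "{x. bary V x v = 0} \<subseteq> affine hull (V - {v})"
proof
  fix x assume "x \<in> {x. bary V x v = 0}"
  then have x: "bary V x v = 0" by simp
  have fin: "finite V" by (rule affine_basis_finite[OF V])
  have "sum (bary V x) (V - {v}) = 1"
    using sum_bary[OF V, of x] x fin assms(2) by (simp add: sum.remove)
  moreover have "(\<Sum>u\<in>V-{v}. bary V x u *\<^sub>R u) = x"
    using bary_repr[OF V, of x] x fin assms(2) by (simp add: sum.remove)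
  ultimately show "x \<in> affine hull (V - {v})"
    using fin by (auto simp: affine_hull_finite)
qed

lemma bary_comp:
  assumes "affine_basis V" "affine_basis U" "k \<in> U"
  shows "(\<Sum>u\<in>V. bary V x u * bary U u k) = bary U x k"
  using bary_sum[OF assms(2) sum_bary[OF assms(1), of x] assms(3), of "\<lambda>u. u"] bary_repr[OF assms(1), of x]
  by simp

text \<open>The nonnegative terms \<open>bary V x u * (a \<bullet> x - a \<bullet> u)\<close> sum to
  0, so each of them vanishes.\<close>

lemma tight_support:
  assumes V: "affine_basis V" and x: "x \<in> convex hull V" and le: "\<And>v. v \<in> V \<Longrightarrow> a \<bullet> v \<le> a \<bullet> x"
    and v: "v \<in> V" "0 < bary V x v"
  shows "a \<bullet> v = a \<bullet> x"
proof -
  have nn: "0 \<le> bary V x u * (a \<bullet> x - a \<bullet> u)" if "u \<in> V" for u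
    using x le that by (simp add: convex_hull_bary[OF V])
  have "(\<Sum>u\<in>V. bary V x u * (a \<bullet> x - a \<bullet> u)) = - (\<Sum>u\<in>V. bary V x u * (a \<bullet> u - a \<bullet> x))"
    by (simp add: sum_negf[symmetric] algebra_simps)
  also have "\<dots> = 0"
    using inner_bary_diff[OF V, of a x "a \<bullet> x"] by simp
  finally have "bary V x v * (a \<bullet> x - a \<bullet> v) = 0"
    using nn v(1) affine_basis_finite[OF V] by (simp add: sum_nonneg_eq_0_iff)
  then show ?thesis
    using v(2) by simp
qed

lemma bary_single_support:
  assumes V: "affine_basis V" and "c \<in> V" "\<And>v. v \<in> V \<Longrightarrow> v \<noteq> c \<Longrightarrow> bary V x v = 0"
  shows "x = c"
proof -
  have fin: "finite V" by (rule affine_basis_finite[OF V])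
  have "(\<Sum>v\<in>V-{c}. bary V x v) = 0" "(\<Sum>v\<in>V-{c}. bary V x v *\<^sub>R v) = 0"
    using assms(3) by (auto intro!: sum.neutral)
  then show ?thesis
    using sum_bary[OF V, of x] bary_repr[OF V, of x] fin assms(2) by (simp add: sum.remove)
qed

definition centroid :: "'a::euclidean_space set \<Rightarrow> 'a" where
  "centroid U = (\<Sum>u\<in>U. (1 / real (card U)) *\<^sub>R u)"

lemma bary_centroid:
  assumes V: "affine_basis V" and "U \<subseteq> V" "U \<noteq> {}" "v \<in> V"
  shows "bary V (centroid U) v = (if v \<in> U then 1 / real (card U) else 0)"
proof -
  have fin: "finite U"
    using affine_basis_finite[OF V] assms(2) finite_subset by blast
  have "bary V (centroid U) v = (\<Sum>u\<in>U. (1 / real (card U)) * bary V u v)"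
    unfolding centroid_def using fin assms(3) by (intro bary_sum[OF V _ assms(4)]) auto
  also have "\<dots> = (\<Sum>u\<in>U. if v = u then 1 / real (card U) else 0)"
    using assms(2,4) by (intro sum.cong refl) (auto simp: bary_vertex[OF V])
  finally show ?thesis
    using fin by simp
qed

lemma centroid_in_hull:
  assumes "finite U" "U \<noteq> {}"
  shows "centroid U \<in> convex hull U"
  unfolding centroid_def using assms by (intro convex_sum convex_convex_hull) (auto intro: hull_inc)

lemma affine_basis_3: "affine_basis (V :: (real^3) set) \<longleftrightarrow> \<not> affine_dependent V \<and> card V = 4"
  by (simp add: affine_basis_def)

subsection \<open>Generic points and perturbation\<close>

lemma interior_Union_closed_empty:
  assumes "finite \<F>" "\<And>F. F \<in> \<F> \<Longrightarrow> closed F \<and> interior F = {}"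
  shows "interior (\<Union>\<F>) = {}"
  using assms by (induction rule: finite_induct) (simp_all add: interior_closed_Un_empty_interior)

lemma avoid_nowhere_dense:
  assumes "finite \<F>" "\<And>F. F \<in> \<F> \<Longrightarrow> closed F \<and> interior F = {}" "open U" "U \<noteq> {}"
  obtains x where "x \<in> U" "\<And>F. F \<in> \<F> \<Longrightarrow> x \<notin> F"
  using interior_Union_closed_empty[OF assms(1,2)] assms(3,4)
  by (metis UnionI interior_maximal subset_empty subsetI)

text \<open>For small \<open>e\<close> the first nonzero number among \<open>A\<close>,
  \<open>B\<close>, \<open>C\<close> dominates, their weights being of order 1, \<open>e\<close> and
  \<open>e\<^sup>2\<close>.\<close>

lemma eventually_lex_pos:
  fixes A B C :: real
  assumes "A > 0 \<or> A = 0 \<and> B > 0 \<or> A = 0 \<and> B = 0 \<and> C > 0"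
  shows "\<forall>\<^sub>F e in at_right 0. (1 - e - e\<^sup>2) * A + e * B + e\<^sup>2 * C > 0"
proof -
  consider "A > 0" | "A = 0" "B > 0" | "A = 0" "B = 0" "C > 0"
    using assms by blast
  then show ?thesis
  proof cases
    case 1
    have "((\<lambda>e. (1 - e - e\<^sup>2) * A + e * B + e\<^sup>2 * C) \<longlongrightarrow> (1 - 0 - 0\<^sup>2) * A + 0 * B + 0\<^sup>2 * C) (at_right 0)"
      by (intro tendsto_intros)
    then show ?thesis
      by (rule order_tendstoD(1)) (use 1 in simp)
  next
    case 2
    have "((\<lambda>e. B + e * C) \<longlongrightarrow> B + 0 * C) (at_right 0)"
      by (intro tendsto_intros)
    then have "\<forall>\<^sub>F e in at_right 0. B + e * C > 0"
      by (rule order_tendstoD(1)) (use 2 in simp)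
    moreover have "\<forall>\<^sub>F e in at_right 0. (e::real) > 0"
      by (rule eventually_at_right_less)
    ultimately show ?thesis
    proof eventually_elim
      case (elim e)
      then have "e * (B + e * C) > 0" by simp
      then show ?case using 2 by (simp add: algebra_simps power2_eq_square)
    qed
  next
    case 3
    have "\<forall>\<^sub>F e in at_right 0. (e::real) > 0"
      by (rule eventually_at_right_less)
    then show ?thesis
      by eventually_elim (use 3 in simp)
  qed
qed

text \<open>Moving from \<open>x\<close> towards \<open>y\<close>, with a second-order correction towards \<open>z\<close>, enters the interior of a
  simplex as soon as its barycentric coordinates are lexicographically positive along \<open>x\<close>, \<open>y\<close>, \<open>z\<close>.
  Two members of a dissection entered by the same such curve coincide.\<close>

lemma eventually_perturb_interior:
  assumes V: "affine_basis V"
    and "\<And>v. v \<in> V \<Longrightarrow> bary V x v > 0 \<or> bary V x v = 0 \<and> bary V y v > 0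
      \<or> bary V x v = 0 \<and> bary V y v = 0 \<and> bary V z v > 0"
  shows "\<forall>\<^sub>F e in at_right 0. (1 - e - e\<^sup>2) *\<^sub>R x + e *\<^sub>R y + e\<^sup>2 *\<^sub>R z \<in> interior (convex hull V)"
proof -
  have "\<forall>\<^sub>F e in at_right 0. \<forall>v\<in>V. (1 - e - e\<^sup>2) * bary V x v + e * bary V y v + e\<^sup>2 * bary V z v > 0"
    using affine_basis_finite[OF V] assms(2) by (intro eventually_ball_finite ballI eventually_lex_pos) auto
  then show ?thesis
    by eventually_elim (simp add: interior_convex_hull_bary[OF V] bary_affine3[OF V])
qed

lemma convex_subset_halfspace_interior:
  fixes S :: "'a::euclidean_space set"
  assumes "convex S" "interior S \<noteq> {}" "\<And>y. y \<in> interior S \<Longrightarrow> a \<bullet> y \<le> b" "y \<in> S"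
  shows "a \<bullet> y \<le> b"
proof -
  have "closure (interior S) \<subseteq> {y. a \<bullet> y \<le> b}"
    using assms(3) by (intro closure_minimal closed_halfspace_le) auto
  then show ?thesis
    using convex_closure_interior[OF assms(1,2)] closure_subset[of S] assms(4) by auto
qed

lemma supporting_functional:
  fixes S :: "'a::euclidean_space set"
  assumes "convex S" "interior S \<noteq> {}" "x \<notin> interior S"
  obtains f where "f \<noteq> 0" "\<And>y. y \<in> S \<Longrightarrow> f \<bullet> y \<le> f \<bullet> x"
proof -
  obtain a b where ab: "a \<noteq> 0" "\<forall>y\<in>interior S. a \<bullet> y \<le> b" "b \<le> a \<bullet> x"
    using separating_hyperplane_sets[of "interior S" "{x}"] assms by (auto simp: convex_interior)
  then have "a \<bullet> y \<le> a \<bullet> x" if "y \<in> S" for y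
    using convex_subset_halfspace_interior[OF assms(1,2) _ that, of a b] by force
  then show ?thesis
    using ab(1) that by blast
qed

lemma separating_functional:
  fixes S :: "'a::euclidean_space set"
  assumes "convex S" "interior S \<noteq> {}" "convex T" "interior T \<noteq> {}" "interior S \<inter> interior T = {}"
  obtains a b where "a \<noteq> 0" "\<And>y. y \<in> S \<Longrightarrow> a \<bullet> y \<le> b" "\<And>y. y \<in> T \<Longrightarrow> b \<le> a \<bullet> y"
proof -
  obtain a b where ab: "a \<noteq> 0" "\<forall>y\<in>interior S. a \<bullet> y \<le> b" "\<forall>y\<in>interior T. b \<le> a \<bullet> y"
    using separating_hyperplane_sets[of "interior S" "interior T"] assms by (auto simp: convex_interior)
  have "a \<bullet> y \<le> b" if "y \<in> S" for y
    using convex_subset_halfspace_interior[OF assms(1,2) _ that, of a b] ab by force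
  moreover have "- a \<bullet> y \<le> - b" if "y \<in> T" for y
    using convex_subset_halfspace_interior[OF assms(3,4) _ that, of "-a" "-b"] ab by force
  ultimately show ?thesis
    using ab(1) that[of a b] by fastforce
qed

lemma inner_less_interior:
  fixes S :: "'a::euclidean_space set"
  assumes "x \<in> interior S" "f \<noteq> 0" "\<And>y. y \<in> S \<Longrightarrow> f \<bullet> y \<le> c"
  shows "f \<bullet> x < c"
proof -
  have "interior S \<subseteq> interior {y. f \<bullet> y \<le> c}"
    using assms(3) by (intro interior_mono) auto
  then show ?thesis
    using assms(1,2) by auto
qed

text \<open>Otherwise \<open>m\<close> would lie strictly between the interior point
  \<open>p\<close> and a point of \<open>S\<close>, and so be interior itself.\<close>

lemma beyond_not_in:
  fixes S :: "'a::euclidean_space set"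
  assumes "convex S" "p \<in> interior S" "m \<notin> interior S" "t > 0"
  shows "(1 + t) *\<^sub>R m - t *\<^sub>R p \<notin> S"
proof
  define q where "q = (1 + t) *\<^sub>R m - t *\<^sub>R p"
  assume "(1 + t) *\<^sub>R m - t *\<^sub>R p \<in> S"
  then have q: "q \<in> closure S"
    using closure_subset by (auto simp: q_def)
  have "p \<noteq> m"
    using assms by auto
  have "q - p = (1 + t) *\<^sub>R (m - p)"
    by (simp add: q_def algebra_simps)
  then have "p \<noteq> q"
    using \<open>p \<noteq> m\<close> assms(4) by auto
  moreover have "m = (1 - 1 / (1 + t)) *\<^sub>R p + (1 / (1 + t)) *\<^sub>R q"
  proof -
    have "(1 / (1 + t)) *\<^sub>R q = ((1 + t) / (1 + t)) *\<^sub>R m - (t / (1 + t)) *\<^sub>R p"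
      by (simp only: q_def scaleR_diff_right scaleR_scaleR times_divide_eq_left mult_1)
    moreover have "(1 + t) / (1 + t) = 1" "1 - 1 / (1 + t) = t / (1 + t)"
      using assms(4) by (simp_all add: divide_simps)
    ultimately have "(1 - 1 / (1 + t)) *\<^sub>R p + (1 / (1 + t)) *\<^sub>R q = m"
      by simp
    then show ?thesis ..
  qed
  ultimately have "m \<in> open_segment p q"
    unfolding in_segment using assms(4) by (intro conjI exI[of _ "1 / (1 + t)"]) auto
  then show False
    using in_interior_closure_convex_segment[OF assms(1,2) q] assms(3) by blast
qed

lemma exists_normal:
  fixes x y :: "real^3"
  obtains N where "N \<noteq> 0" "N \<bullet> x = 0" "N \<bullet> y = 0"
proof -
  have "dim {x, y} \<le> 2"
    by (rule order_trans[OF dim_le_card']) (auto simp: card_insert_if)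
  then have "dim {x, y} < DIM(real^3)"
    by simp
  then obtain N where "N \<noteq> 0" "\<And>z. z \<in> span {x, y} \<Longrightarrow> orthogonal N z"
    using orthogonal_to_subspace_exists by blast
  then show ?thesis
    using that[of N] by (simp add: orthogonal_def span_base)
qed

subsection \<open>Counting faces of one tetrahedron\<close>

lemma card_4_split:
  assumes "card V = 4" "a \<in> V" "b \<in> V" "a \<noteq> b"
  obtains c d where "V = {a, b, c, d}" "c \<notin> {a, b}" "d \<notin> {a, b, c}"
proof -
  have fin: "finite V"
    using assms(1) card_ge_0_finite by force
  then have "card (V - {a, b}) = 2"
    using assms by (simp add: card_Diff_subset)
  then obtain c d where "V - {a, b} = {c, d}" "c \<noteq> d"
    by (auto simp: card_2_iff)
  moreover from this have "V = {a, b, c, d}"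
    using assms by auto
  ultimately show ?thesis
    using that by (metis Diff_iff insert_iff)
qed

lemma sum_card_swap:
  assumes "finite I" "finite J"
  shows "(\<Sum>i\<in>I. card {j \<in> J. R i j}) = (\<Sum>j\<in>J. card {i \<in> I. R i j})"
  unfolding card_eq_sum sum.inter_filter[OF assms(1)] sum.inter_filter[OF assms(2)] by (rule sum.swap)

definition pairs :: "'a set \<Rightarrow> 'a set set" where
  "pairs A = {e. e \<subseteq> A \<and> card e = 2}"

lemma finite_pairs: "finite A \<Longrightarrow> finite (pairs A)"
  by (simp add: pairs_def)

lemma card_pairs: "finite A \<Longrightarrow> card (pairs A) = card A choose 2"
  by (simp add: pairs_def n_subsets)

lemma pairs_nonempty: "e \<in> pairs A \<Longrightarrow> e \<noteq> {}"
  by (auto simp: pairs_def)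

lemma pairs_4:
  assumes "c \<notin> {a, b}" "d \<notin> {a, b, c}" "a \<noteq> b"
  shows "pairs {a, b, c, d} = {{a, b}, {a, c}, {a, d}, {b, c}, {b, d}, {c, d}}"
proof (rule sym, rule card_subset_eq)
  show "finite (pairs {a, b, c, d})"
    by (simp add: finite_pairs)
  show "{{a, b}, {a, c}, {a, d}, {b, c}, {b, d}, {c, d}} \<subseteq> pairs {a, b, c, d}"
    using assms by (auto simp: pairs_def)
  have "card {a, b, c, d} = 4"
    using assms by auto
  then have "card (pairs {a, b, c, d}) = 6"
    by (simp add: card_pairs choose_two del: card_insert_disjoint)
  then show "card {{a, b}, {a, c}, {a, d}, {b, c}, {b, d}, {c, d}} = card (pairs {a, b, c, d})"
    using assms by (auto simp: card_insert_if doubleton_eq_iff)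
qed

text \<open>With \<open>k\<close> positive values the claim reads C(k,2) + C(4-k,2) = 2 + C(k,3) +
  C(4-k,3). The proof runs through the sign patterns.\<close>

lemma sign_count:
  fixes f :: "'a \<Rightarrow> real"
  assumes "card V = 4" "\<And>v. v \<in> V \<Longrightarrow> f v \<noteq> 0" "\<exists>v\<in>V. 0 < f v"
  shows "card {e \<in> pairs V. \<forall>u\<in>V-e. 0 < f u} + card {e \<in> pairs V. \<forall>u\<in>V-e. f u < 0}
     = 2 + card {v \<in> V. \<forall>u\<in>V-{v}. 0 < f u} + card {v \<in> V. \<forall>u\<in>V-{v}. f u < 0}"
proof -
  obtain B where "B \<subseteq> V" "card B = 2"
    using obtain_subset_with_card_n[of 2 V] assms(1) by auto
  then obtain a b where ab: "a \<in> V" "b \<in> V" "a \<noteq> b"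
    by (auto simp: card_2_iff)
  obtain c d where V: "V = {a, b, c, d}" and cd: "c \<notin> {a, b}" "d \<notin> {a, b, c}"
    using card_4_split[OF assms(1) ab] .
  have vs: "{v \<in> V. Q v} = (if Q a then {a} else {}) \<union> (if Q b then {b} else {}) \<union>
      (if Q c then {c} else {}) \<union> (if Q d then {d} else {})" for Q
    unfolding V by auto
  have es: "{e \<in> pairs V. Q e} = (if Q {a,b} then {{a,b}} else {}) \<union> (if Q {a,c} then {{a,c}} else {}) \<union>
      (if Q {a,d} then {{a,d}} else {}) \<union> (if Q {b,c} then {{b,c}} else {}) \<union>
      (if Q {b,d} then {{b,d}} else {}) \<union> (if Q {c,d} then {{c,d}} else {})" for Q
    unfolding V pairs_4[OF cd ab(3)] by auto
  have D: "V - {a,b} = {c,d}" "V - {a,c} = {b,d}" "V - {a,d} = {b,c}" "V - {b,c} = {a,d}"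
    "V - {b,d} = {a,c}" "V - {c,d} = {a,b}" "V - {a} = {b,c,d}" "V - {b} = {a,c,d}"
    "V - {c} = {a,b,d}" "V - {d} = {a,b,c}"
    using V cd ab(3) by auto
  have "f a < 0 \<or> f a > 0" "f b < 0 \<or> f b > 0" "f c < 0 \<or> f c > 0" "f d < 0 \<or> f d > 0"
    using assms(2) V by (auto simp: less_linear neq_iff)
  moreover have "f a > 0 \<or> f b > 0 \<or> f c > 0 \<or> f d > 0"
    using assms(3) V by auto
  ultimately show ?thesis
    unfolding vs es D using cd ab(3)
    by (elim disjE) (simp_all add: card_insert_if doubleton_eq_iff less_asym[of "_::real"])
qed

lemma sum_4:
  fixes f :: "'a \<Rightarrow> real"
  assumes "V = {a, b, c, d}" "a \<noteq> b" "c \<notin> {a, b}" "d \<notin> {a, b, c}"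
  shows "sum f V = f a + f b + f c + f d"
proof -
  have "a \<notin> {b, c, d}" "b \<notin> {c, d}" "c \<notin> {d}"
    using assms by auto
  then show ?thesis
    unfolding assms(1) by simp
qed

subsection \<open>Counting edges around a generic point\<close>

text \<open>A tetrahedron is represented by its vertex set, so that barycentric coordinates and the
  counting of vertices and edges apply directly.\<close>

locale tetrahedral_dissection =
  fixes W :: "(real^3) set" and \<V> :: "(real^3) set set"
  assumes finite_W: "finite W"
    and extreme: "w \<in> W \<Longrightarrow> w extreme_point_of (convex hull W)"
    and basis: "V \<in> \<V> \<Longrightarrow> affine_basis V"
    and sub: "V \<in> \<V> \<Longrightarrow> V \<subseteq> W"
    and disjoint: "U \<in> \<V> \<Longrightarrow> V \<in> \<V> \<Longrightarrow> U \<noteq> V \<Longrightarrow>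
      interior (convex hull U) \<inter> interior (convex hull V) = {}"
    and cover: "(\<Union>V\<in>\<V>. convex hull V) = convex hull W"
    and interior_nonempty: "interior (convex hull W) \<noteq> {}"
begin

abbreviation "P \<equiv> convex hull W"

lemma finite_\<V>: "finite \<V>"
  using finite_W sub by (meson PowI finite_Pow_iff finite_subset subsetI)

lemma card_V: "V \<in> \<V> \<Longrightarrow> card V = 4"
  using basis affine_basis_3 by blast

lemma finite_V: "V \<in> \<V> \<Longrightarrow> finite V"
  using basis affine_basis_finite by blast

lemma hull_sub: "V \<in> \<V> \<Longrightarrow> convex hull V \<subseteq> P"
  using sub hull_mono by blast

lemma W_sub: "w \<in> W \<Longrightarrow> w \<in> P"
  by (simp add: hull_inc)

lemma vertex_not_interior: "w \<in> W \<Longrightarrow> w \<notin> interior P"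
  using extreme extreme_point_not_in_interior by blast

lemma vertex_in_hull:
  assumes "V \<in> \<V>" "w \<in> W" "w \<in> convex hull V"
  shows "w \<in> V"
  using extreme[OF assms(2)] assms(3) hull_sub[OF assms(1)]
  by (meson extreme_point_of_convex_hull extreme_point_of_def subsetD)

lemma eventually_interior_unique:
  assumes "U \<in> \<V>" "V \<in> \<V>"
    and "\<forall>\<^sub>F e in at_right (0::real). g e \<in> interior (convex hull U)"
    and "\<forall>\<^sub>F e in at_right (0::real). g e \<in> interior (convex hull V)"
  shows "U = V"
proof (rule ccontr)
  assume "U \<noteq> V"
  have "\<forall>\<^sub>F e in at_right (0::real). False"
    using assms(3,4) by eventually_elim (use disjoint[OF assms(1,2) \<open>U \<noteq> V\<close>] in blast)
  then show False
    by simp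
qed

text \<open>Geometrically, \<open>p\<close> is an interior point on no facet plane of a tetrahedron,
  so all its coordinates have a strict sign.\<close>

definition generic :: "real^3 \<Rightarrow> bool" where
  "generic p \<longleftrightarrow> p \<in> interior P \<and> (\<forall>V\<in>\<V>. \<forall>v\<in>V. bary V p v \<noteq> 0)"

lemma generic_exists:
  assumes "open U" "U \<noteq> {}" "U \<subseteq> P"
  obtains p where "p \<in> U" "generic p"
proof -
  let ?F = "(\<lambda>(V,v). affine hull (V - {v})) ` (SIGMA V:\<V>. V)"
  have "finite ?F"
    using finite_\<V> finite_V by blast
  moreover have "closed F \<and> interior F = {}" if F: "F \<in> ?F" for F
  proof -
    obtain V v where F: "V \<in> \<V>" "v \<in> V" "F = affine hull (V - {v})"
      using F by auto
    moreover from this have "card (V - {v}) \<le> DIM(real^3)"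
      using card_V finite_V by simp
    ultimately show ?thesis
      using finite_V empty_interior_affine_hull[of "V - {v}"] by (simp add: closed_affine_hull)
  qed
  ultimately obtain p where p: "p \<in> U" "\<And>F. F \<in> ?F \<Longrightarrow> p \<notin> F"
    using avoid_nowhere_dense[of ?F U] assms(1,2) by blast
  moreover have "p \<in> interior P"
    using p(1) assms interior_maximal by blast
  moreover have "bary V p v \<noteq> 0" if "V \<in> \<V>" "v \<in> V" for V v
    using p(2)[of "affine hull (V - {v})"] that bary_zero_subset_affine_hull[OF basis, of V v] by auto
  ultimately show ?thesis
    using that by (auto simp: generic_def)
qed

text \<open>Finitely many tetrahedra cover the segment from \<open>x\<close> to \<open>p\<close>, so
  one of them meets it arbitrarily close to \<open>x\<close> and, being closed, contains
  \<open>x\<close>. A coordinate vanishing at \<open>x\<close> has the sign of its value at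
  \<open>p\<close> along the segment, so this value is nonnegative, and by genericity
  positive.\<close>

lemma covering_towards:
  assumes "x \<in> P" "generic p"
  obtains V where "V \<in> \<V>" "x \<in> convex hull V" "\<And>v. v \<in> V \<Longrightarrow> bary V x v = 0 \<Longrightarrow> 0 < bary V p v"
proof -
  let ?y = "\<lambda>e::real. (1 - e) *\<^sub>R x + e *\<^sub>R p"
  have "p \<in> P"
    using assms(2) interior_subset by (auto simp: generic_def)
  have ev: "\<forall>\<^sub>F e in at_right (0::real). e > 0 \<and> e < 1"
    by (auto simp: eventually_at_right_field intro: exI[of _ 1])
  then have "\<forall>\<^sub>F e in at_right (0::real). \<exists>V\<in>\<V>. ?y e \<in> convex hull V"
  proof eventually_elim
    case (elim e)
    then have "?y e \<in> P"
      using assms(1) \<open>p \<in> P\<close> by (intro convexD) auto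
    then show ?case
      using cover by blast
  qed
  then have "\<exists>V\<in>\<V>. \<exists>\<^sub>F e in at_right 0. ?y e \<in> convex hull V"
    using finite_\<V> by (intro frequently_bex_finite) (auto intro: eventually_frequently)
  then obtain V where V: "V \<in> \<V>" and fr: "\<exists>\<^sub>F e in at_right 0. ?y e \<in> convex hull V"
    by blast
  have "x \<in> convex hull V"
  proof (rule ccontr)
    assume "x \<notin> convex hull V"
    moreover have "open (- (convex hull V))"
      using finite_V[OF V] by (simp add: open_Compl compact_imp_closed finite_imp_compact_convex_hull)
    moreover have "(?y \<longlongrightarrow> (1 - 0) *\<^sub>R x + 0 *\<^sub>R p) (at_right 0)"
      by (intro tendsto_intros)
    ultimately have "\<forall>\<^sub>F e in at_right 0. ?y e \<in> - (convex hull V)"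
      by (intro topological_tendstoD) auto
    then show False
      using fr by (auto simp: frequently_def elim: eventually_mono)
  qed
  moreover obtain e where e: "0 < e" "e < 1" "?y e \<in> convex hull V"
    using frequently_ex[OF frequently_eventually_conj[OF fr ev]] by auto
  moreover have "0 < bary V p v" if v: "v \<in> V" "bary V x v = 0" for v
  proof -
    have "0 \<le> e * bary V p v"
      using e(3) v by (auto simp: convex_hull_bary[OF basis[OF V]] bary_affine[OF basis[OF V]])
    then have "0 \<le> bary V p v"
      using e(1) by (simp add: zero_le_mult_iff)
    moreover have "bary V p v \<noteq> 0"
      using assms(2) V v by (auto simp: generic_def)
    ultimately show ?thesis by simp
  qed
  ultimately show ?thesis
    using that V by blast
qed

text \<open>\<open>towards p U\<close> collects the tetrahedra entered by moving from a relative interior point of the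
  face \<open>U\<close> towards \<open>p\<close>; \<open>away p U\<close> those entered by moving in the opposite direction.\<close>

definition towards :: "real^3 \<Rightarrow> (real^3) set \<Rightarrow> (real^3) set set" where
  "towards p U = {V \<in> \<V>. U \<subseteq> V \<and> (\<forall>u\<in>V-U. 0 < bary V p u)}"

definition away :: "real^3 \<Rightarrow> (real^3) set \<Rightarrow> (real^3) set set" where
  "away p U = {V \<in> \<V>. U \<subseteq> V \<and> (\<forall>u\<in>V-U. bary V p u < 0)}"

lemma finite_towards: "finite (towards p U)" and finite_away: "finite (away p U)"
  using finite_\<V> by (auto simp: towards_def away_def)

lemma eventually_towards:
  assumes "V \<in> towards p U" "U \<noteq> {}"
  shows "\<forall>\<^sub>F e in at_right 0. (1 - e - e\<^sup>2) *\<^sub>R centroid U + e *\<^sub>R p + e\<^sup>2 *\<^sub>R p \<in> interior (convex hull V)"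
proof -
  have V: "V \<in> \<V>" "U \<subseteq> V" "\<forall>u\<in>V-U. 0 < bary V p u"
    using assms(1) by (auto simp: towards_def)
  have "card U > 0"
    using finite_V[OF V(1)] V(2) assms(2) by (meson card_gt_0_iff finite_subset)
  then show ?thesis
    using V assms(2) basis by (intro eventually_perturb_interior) (auto simp: bary_centroid)
qed

text \<open>The point \<open>q\<close> is the reflection of \<open>p\<close> in the centroid of
  \<open>U\<close>. Coordinates of vertices outside \<open>U\<close> vanish at the centroid, so they
  change sign from \<open>p\<close> to \<open>q\<close>.\<close>

lemma eventually_away:
  assumes "V \<in> away p U" "U \<noteq> {}"
  defines "q \<equiv> 2 *\<^sub>R centroid U + (-1) *\<^sub>R p"
  shows "\<forall>\<^sub>F e in at_right 0. (1 - e - e\<^sup>2) *\<^sub>R centroid U + e *\<^sub>R q + e\<^sup>2 *\<^sub>R q \<in> interior (convex hull V)"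
proof -
  have V: "V \<in> \<V>" "U \<subseteq> V" "\<forall>u\<in>V-U. bary V p u < 0"
    using assms(1) by (auto simp: away_def)
  have "card U > 0"
    using finite_V[OF V(1)] V(2) assms(2) by (meson card_gt_0_iff finite_subset)
  moreover have "bary V q u = 2 * bary V (centroid U) u + (-1) * bary V p u" if "u \<in> V" for u
    unfolding q_def by (rule bary_affine[OF basis[OF V(1)] _ that]) simp
  ultimately show ?thesis
    using V assms(2) basis by (intro eventually_perturb_interior) (auto simp: bary_centroid)
qed

lemma card_towards_le: "U \<noteq> {} \<Longrightarrow> card (towards p U) \<le> 1"
proof -
  assume "U \<noteq> {}"
  then have "V = V'" if "V \<in> towards p U" "V' \<in> towards p U" for V V'
    using that eventually_interior_unique[OF _ _ eventually_towards eventually_towards] by (auto simp: towards_def)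
  then show ?thesis
    by (simp add: card_le_Suc0_iff_eq[OF finite_towards])
qed

lemma card_away_le: "U \<noteq> {} \<Longrightarrow> card (away p U) \<le> 1"
proof -
  assume "U \<noteq> {}"
  then have "V = V'" if "V \<in> away p U" "V' \<in> away p U" for V V'
    using that eventually_interior_unique[OF _ _ eventually_away eventually_away] by (auto simp: away_def)
  then show ?thesis
    by (simp add: card_le_Suc0_iff_eq[OF finite_away])
qed

text \<open>The curve entering such a tetrahedron would stay in \<open>P\<close> while continuing
  the segment from \<open>p\<close> beyond a point that is not interior to \<open>P\<close>.\<close>

lemma away_empty:
  assumes "U \<noteq> {}" "centroid U \<notin> interior P" "p \<in> interior P"
  shows "away p U = {}"
proof (rule ccontr)
  assume "away p U \<noteq> {}"
  then obtain V where V: "V \<in> away p U" by blast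
  have "\<forall>\<^sub>F e in at_right (0::real). False"
    using eventually_away[OF V assms(1)] eventually_at_right_less
  proof eventually_elim
    case (elim e)
    have "V \<in> \<V>"
      using V by (simp add: away_def)
    have "(1 - e - e\<^sup>2) *\<^sub>R centroid U + e *\<^sub>R (2 *\<^sub>R centroid U + (-1) *\<^sub>R p) + e\<^sup>2 *\<^sub>R (2 *\<^sub>R centroid U + (-1) *\<^sub>R p)
       = (1 + (e + e\<^sup>2)) *\<^sub>R centroid U - (e + e\<^sup>2) *\<^sub>R p"
      by (simp add: algebra_simps flip: scaleR_2)
    then have "(1 + (e + e\<^sup>2)) *\<^sub>R centroid U - (e + e\<^sup>2) *\<^sub>R p \<in> P"
      using elim(1) hull_sub[OF \<open>V \<in> \<V>\<close>] interior_subset[of "convex hull V"] by auto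
    moreover have "e + e\<^sup>2 > 0"
      using elim(2) by (simp add: add_pos_pos)
    ultimately show ?case
      using beyond_not_in[OF _ assms(3,2)] by auto
  qed
  then show False by simp
qed

lemma centroid_singleton: "centroid {v} = v"
  by (simp add: centroid_def)

text \<open>A tetrahedron entered from \<open>v\<close> towards \<open>p\<close> exists by covering;
  it has \<open>v\<close> as a vertex because \<open>v\<close> is extreme in
  \<open>P\<close>.\<close>

lemma card_towards_vertex:
  assumes "v \<in> W" "generic p"
  shows "card (towards p {v}) = 1"
proof -
  obtain V where V: "V \<in> \<V>" "v \<in> convex hull V" "\<And>u. u \<in> V \<Longrightarrow> bary V v u = 0 \<Longrightarrow> 0 < bary V p u"
    using covering_towards[OF W_sub[OF assms(1)] assms(2)] by metis
  have "v \<in> V"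
    by (rule vertex_in_hull[OF V(1) assms(1) V(2)])
  then have "V \<in> towards p {v}"
    using V(1,3) bary_vertex[OF basis[OF V(1)]] by (auto simp: towards_def)
  then have "card (towards p {v}) > 0"
    using finite_towards card_gt_0_iff by blast
  then show ?thesis
    using card_towards_le[of "{v}" p] by simp
qed

text \<open>\<open>sign_count\<close> is summed over all tetrahedra and the sums are exchanged. Each
  vertex of \<open>P\<close> contributes 1 through \<open>towards\<close> and 0 through
  \<open>away\<close>, as it is not interior.\<close>

lemma double_count:
  assumes "generic p"
  shows "2 * card \<V> + card W = (\<Sum>e\<in>pairs W. card (towards p e) + card (away p e))"
proof -
  have E: "(\<Sum>e\<in>pairs W. card {V \<in> \<V>. e \<subseteq> V \<and> Q V e}) = (\<Sum>V\<in>\<V>. card {e \<in> pairs V. Q V e})" for Q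
  proof -
    have "{e \<in> pairs W. e \<subseteq> V \<and> Q V e} = {e \<in> pairs V. Q V e}" if "V \<in> \<V>" for V
      using sub[OF that] by (auto simp: pairs_def)
    then show ?thesis
      by (simp add: sum_card_swap finite_\<V> finite_pairs finite_W)
  qed
  have F: "(\<Sum>w\<in>W. card {V \<in> \<V>. {w} \<subseteq> V \<and> Q V w}) = (\<Sum>V\<in>\<V>. card {w \<in> V. Q V w})" for Q
  proof -
    have "{w \<in> W. {w} \<subseteq> V \<and> Q V w} = {w \<in> V. Q V w}" if "V \<in> \<V>" for V
      using sub[OF that] by auto
    then show ?thesis
      by (simp add: sum_card_swap finite_\<V> finite_W)
  qed
  have "(\<Sum>e\<in>pairs W. card (towards p e) + card (away p e))
     = (\<Sum>V\<in>\<V>. card {e \<in> pairs V. \<forall>u\<in>V-e. 0 < bary V p u} + card {e \<in> pairs V. \<forall>u\<in>V-e. bary V p u < 0})"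
    by (simp add: towards_def away_def E sum.distrib)
  also have "\<dots> = (\<Sum>V\<in>\<V>. 2 + card {v \<in> V. \<forall>u\<in>V-{v}. 0 < bary V p u} + card {v \<in> V. \<forall>u\<in>V-{v}. bary V p u < 0})"
  proof (intro sum.cong refl sign_count)
    fix V assume V: "V \<in> \<V>"
    show "card V = 4" by (rule card_V[OF V])
    show "bary V p v \<noteq> 0" if "v \<in> V" for v
      using assms V that by (simp add: generic_def)
    show "\<exists>v\<in>V. 0 < bary V p v"
      using sum_bary[OF basis[OF V], of p] sum_nonpos[of V "bary V p"] by force
  qed
  also have "\<dots> = 2 * card \<V> + (\<Sum>w\<in>W. card (towards p {w})) + (\<Sum>w\<in>W. card (away p {w}))"
    unfolding sum.distrib towards_def away_def F[of "\<lambda>V v. \<forall>u\<in>V-{v}. 0 < bary V p u"]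
      F[of "\<lambda>V v. \<forall>u\<in>V-{v}. bary V p u < 0"] by simp
  also have "(\<Sum>w\<in>W. card (towards p {w})) = card W"
    by (simp add: card_towards_vertex[OF _ assms])
  also have "(\<Sum>w\<in>W. card (away p {w})) = 0"
    using away_empty[of "{_}" p] vertex_not_interior assms
    by (simp add: centroid_singleton generic_def)
  finally show ?thesis
    by simp
qed

subsection \<open>Boundary triangles and their edges\<close>

text \<open>Of three collinear points one lies between the others, which is impossible for an
  extreme point of \<open>P\<close>.\<close>

lemma three_vertices_independent:
  assumes "a \<in> W" "b \<in> W" "c \<in> W" "a \<noteq> b" "a \<noteq> c" "b \<noteq> c"
  shows "\<not> affine_dependent {a, b, c}"
proof
  have nb: "\<not> between (y, z) x" if "x \<in> W" "y \<in> W" "z \<in> W" "x \<noteq> y" "x \<noteq> z" for x y z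
    using extreme[OF that(1)] W_sub[OF that(2)] W_sub[OF that(3)] that(4,5)
    by (auto simp: between_mem_segment extreme_point_of_def open_segment_def)
  assume "affine_dependent {a, b, c}"
  then have "collinear {a, b, c}"
    by (simp add: collinear_3_eq_affine_dependent)
  then show False
    using nb assms by (auto simp: collinear_between_cases)
qed

text \<open>The pair \<open>(V, d)\<close> stands for the facet of the tetrahedron \<open>V\<close> opposite to the vertex \<open>d\<close>; it lies in
  the boundary of \<open>P\<close> iff all of \<open>P\<close> is on the same side of its plane as \<open>d\<close>.\<close>

definition triangles :: "((real^3) set \<times> (real^3)) set" where
  "triangles = {(V, d). V \<in> \<V> \<and> d \<in> V \<and> (\<forall>x\<in>W. 0 \<le> bary V x d)}"

lemma triangles_nonneg:
  assumes "(V, d) \<in> triangles" "x \<in> P"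
  shows "0 \<le> bary V x d"
proof -
  have V: "affine_basis V" "d \<in> V"
    using assms(1) basis by (auto simp: triangles_def)
  have "convex {x. 0 \<le> bary V x d}"
    by (rule convexI) (simp add: bary_affine[OF V(1) _ V(2)])
  moreover have "W \<subseteq> {x. 0 \<le> bary V x d}"
    using assms(1) by (auto simp: triangles_def)
  ultimately have "P \<subseteq> {x. 0 \<le> bary V x d}"
    by (intro hull_minimal)
  then show ?thesis
    using assms(2) by blast
qed

text \<open>A small step from \<open>x\<close> away from \<open>d\<close> stays in \<open>P\<close>,
  where the coordinate of \<open>d\<close> is nonnegative, although the step has decreased it if it
  was 0 at \<open>x\<close>.\<close>

lemma triangles_pos:
  assumes "(V, d) \<in> triangles" "x \<in> interior P"
  shows "0 < bary V x d"
proof -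
  have V: "affine_basis V" "d \<in> V"
    using assms(1) basis by (auto simp: triangles_def)
  have "((\<lambda>e::real. (1 + e) *\<^sub>R x + (- e) *\<^sub>R d) \<longlongrightarrow> (1 + 0) *\<^sub>R x + (- 0) *\<^sub>R d) (at_right 0)"
    by (intro tendsto_intros)
  then have "\<forall>\<^sub>F e in at_right 0. (1 + e) *\<^sub>R x + (- e) *\<^sub>R d \<in> interior P"
    using assms(2) by (intro topological_tendstoD) auto
  then have "\<forall>\<^sub>F e in at_right 0. 0 < e \<and> (1 + e) *\<^sub>R x + (- e) *\<^sub>R d \<in> interior P"
    using eventually_at_right_less by (rule eventually_elim2) auto
  then obtain e where e: "0 < e" "(1 + e) *\<^sub>R x + (- e) *\<^sub>R d \<in> P"
    using eventually_happens' interior_subset by (metis (no_types, lifting) subsetD trivial_limit_at_right_real)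
  have "0 \<le> (1 + e) * bary V x d + (- e) * bary V d d"
    using triangles_nonneg[OF assms(1) e(2)] bary_affine[OF V(1) _ V(2), of "1 + e" "- e" x d] by simp
  then have "0 < (1 + e) * bary V x d"
    using e(1) by (simp add: bary_vertex[OF V(1) V(2) V(2)])
  then show ?thesis
    using e(1) by (simp add: zero_less_mult_iff)
qed

text \<open>These segments need not be edges of \<open>P\<close>; diagonals of its faces can
  occur.\<close>

definition edges :: "(real^3) set set" where
  "edges = {e \<in> pairs W. \<exists>(V, d)\<in>triangles. e \<subseteq> V - {d}}"

lemma finite_edges: "finite edges"
  by (simp add: edges_def finite_pairs finite_W)

lemma finite_triangles: "finite triangles"
proof -
  have "triangles \<subseteq> (SIGMA V:\<V>. V)"
    by (auto simp: triangles_def)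
  then show ?thesis
    using finite_\<V> finite_V by (auto intro: finite_subset)
qed

lemma edgeE:
  assumes "e \<subseteq> V - {d}" "(V, d) \<in> triangles" "a \<noteq> b" "e = {a, b}"
  obtains c where "V = {a, b, c, d}" "c \<notin> {a, b}" "d \<notin> {a, b, c}"
proof -
  have V: "card V = 4" "d \<in> V"
    using assms(2) card_V by (auto simp: triangles_def)
  obtain c d' where cd: "V = {a, b, c, d'}" "c \<notin> {a, b}" "d' \<notin> {a, b, c}"
    using card_4_split[OF V(1), of a b] assms by auto
  show ?thesis
  proof (cases "d = d'")
    case True
    then show ?thesis using that cd by blast
  next
    case False
    then have "d = c" using V(2) cd(1) assms(1,4) by auto
    then show ?thesis using that[of d'] cd by auto
  qed
qed

lemma edge_not_interior:
  assumes "e \<in> edges"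
  shows "centroid e \<notin> interior P"
proof
  obtain V d where Vd: "(V, d) \<in> triangles" "e \<subseteq> V - {d}" "e \<noteq> {}"
    using assms pairs_nonempty unfolding edges_def by blast
  assume "centroid e \<in> interior P"
  then have "0 < bary V (centroid e) d"
    by (rule triangles_pos[OF Vd(1)])
  moreover have "bary V (centroid e) d = 0"
    using Vd basis by (subst bary_centroid) (auto simp: triangles_def)
  ultimately show False by simp
qed

text \<open>Let \<open>U\<close> be entered from the midpoint \<open>m\<close> of \<open>e\<close>
  towards \<open>p\<close>. If the vertices of \<open>U\<close> supporting \<open>m\<close> lie on
  the line of \<open>e\<close>, they are the ends of \<open>e\<close>, and \<open>U\<close> is as
  desired. Otherwise they lie in the plane of the boundary triangle on both sides of that line, and
  the one on the side of \<open>c\<close> forces \<open>U = V\<close>, a contradiction.\<close>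

lemma edge_towards:
  assumes "e \<in> edges" "generic p"
  shows "towards p e \<noteq> {}"
proof -
  obtain V d where Vd: "(V, d) \<in> triangles" "e \<subseteq> V - {d}" and e: "e \<in> pairs W"
    using assms(1) by (auto simp: edges_def)
  obtain a b where ab: "e = {a, b}" "a \<noteq> b"
    using e by (auto simp: pairs_def card_2_iff)
  obtain c where V: "V = {a, b, c, d}" and c: "c \<notin> {a, b}" and d: "d \<notin> {a, b, c}"
    using edgeE[OF Vd(2,1) ab(2,1)] .
  have bV: "V \<in> \<V>" "affine_basis V"
    using Vd basis by (auto simp: triangles_def)
  have W: "a \<in> W" "b \<in> W"
    using e ab by (auto simp: pairs_def)
  define m where "m = centroid e"
  have m: "bary V m a = 1/2" "bary V m b = 1/2" "bary V m c = 0" "bary V m d = 0"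
    using ab c d V bV by (auto simp: m_def bary_centroid)
  have "m \<in> P"
    unfolding m_def using centroid_in_hull[of e] hull_mono[of e W convex] e ab by (auto simp: pairs_def)
  then obtain U where U: "U \<in> \<V>" "m \<in> convex hull U"
      and pU: "\<And>v. v \<in> U \<Longrightarrow> bary U m v = 0 \<Longrightarrow> 0 < bary U p v"
    using covering_towards[OF _ assms(2)] by metis
  have bU: "affine_basis U" by (rule basis[OF U(1)])
  have nn: "0 \<le> bary U m u" if "u \<in> U" for u
    using U(2) that by (simp add: convex_hull_bary[OF bU])
  have comp: "(\<Sum>u\<in>U. bary U m u * bary V u k) = bary V m k" if "k \<in> V" for k
    by (rule bary_comp[OF bU bV(2) that])
  \<comment> \<open>The coordinate of \<open>d\<close> is nonnegative on \<open>P\<close> and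
    vanishes at \<open>m\<close>, hence at every vertex that supports \<open>m\<close>.\<close>
  have d0: "bary V u d = 0" if "u \<in> U" "0 < bary U m u" for u
  proof -
    have "\<forall>u\<in>U. bary U m u * bary V u d = 0"
      using comp[of d] m(4) V nn triangles_nonneg[OF Vd(1) W_sub] sub[OF U(1)] finite_V[OF U(1)]
      by (subst sum_nonneg_eq_0_iff[symmetric]) auto
    then show ?thesis using that by auto
  qed
  show ?thesis
  proof (cases "\<exists>u\<in>U. 0 < bary U m u \<and> bary V u c \<noteq> 0")
    case False
    \<comment> \<open>With the coordinates of \<open>c\<close> and \<open>d\<close> zero,
      \<open>u\<close> is on the line through \<open>a\<close> and \<open>b\<close>, which contains
      no third vertex.\<close>
    have ue: "u \<in> e" if u: "u \<in> U" "0 < bary U m u" for u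
    proof (rule ccontr)
      assume "u \<notin> e"
      then have "\<not> affine_dependent {u, a, b}"
        using W sub[OF U(1)] u ab by (intro three_vertices_independent) auto
      moreover have "u \<in> affine hull {a, b}"
      proof -
        have "bary V u a + bary V u b = 1" "bary V u a *\<^sub>R a + bary V u b *\<^sub>R b = u"
          using sum_bary[OF bV(2), of u] bary_repr[OF bV(2), of u] False d0[OF u] u ab c d
          by (auto simp: V)
        then show ?thesis
          unfolding affine_hull_2 by (metis (mono_tags, lifting) mem_Collect_eq)
      qed
      ultimately show False
        using \<open>u \<notin> e\<close> ab by (auto simp: affine_dependent_def insert_Diff_if)
    qed
    have "k \<in> U" if "k \<in> e" for k
    proof -
      have "k \<in> V" "bary V m k = 1/2"
        using that ab V m by auto
      then have "(\<Sum>u\<in>U. bary U m u * bary V u k) \<noteq> 0"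
        using comp[of k] by simp
      then obtain u where u: "u \<in> U" "bary U m u * bary V u k \<noteq> 0"
        by (meson sum.neutral)
      then have "u \<in> e"
        using ue nn[OF u(1)] by fastforce
      then have "u = k"
        using u(2) bary_vertex[OF bV(2) \<open>k \<in> V\<close>, of u] Vd(2) by (auto split: if_splits)
      then show ?thesis using u(1) by simp
    qed
    moreover have "0 < bary U p u" if "u \<in> U - e" for u
      using pU ue nn that by fastforce
    ultimately show ?thesis
      using U(1) by (auto simp: towards_def)
  next
    case True
    have "(\<Sum>u\<in>U. bary U m u * bary V u c) = 0"
      using comp[of c] m V by simp
    then have "\<exists>u\<in>U. 0 < bary U m u * bary V u c"
    proof (rule contrapos_pp)
      assume neg: "\<not> (\<exists>u\<in>U. 0 < bary U m u * bary V u c)"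
      obtain u where "u \<in> U" "bary U m u * bary V u c \<noteq> 0"
        using True by auto
      then have "(\<Sum>u\<in>U. bary U m u * bary V u c) < (\<Sum>u\<in>U. 0)"
        using neg finite_V[OF U(1)] by (intro sum_strict_mono_ex1) (auto simp: not_less intro!: bexI[of _ u] order_neq_le_trans)
      then show "(\<Sum>u\<in>U. bary U m u * bary V u c) \<noteq> 0" by simp
    qed
    then obtain u where u: "u \<in> U" "0 < bary U m u" "0 < bary V u c"
      using nn by (auto simp: zero_less_mult_iff dest: not_less[THEN iffD2])
    \<comment> \<open>The curve from \<open>m\<close> towards \<open>u\<close>, bent towards
      \<open>p\<close>, enters both: in \<open>V\<close> the coordinates of \<open>a\<close>,
      \<open>b\<close> are positive at \<open>m\<close>, that of \<open>c\<close> at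
      \<open>u\<close>, and that of \<open>d\<close> at \<open>p\<close>.\<close>
    have "U = V"
    proof (rule eventually_interior_unique[OF U(1) bV(1)])
      show "\<forall>\<^sub>F e in at_right 0. (1 - e - e\<^sup>2) *\<^sub>R m + e *\<^sub>R u + e\<^sup>2 *\<^sub>R p \<in> interior (convex hull U)"
      proof (rule eventually_perturb_interior[OF bU])
        fix v assume v: "v \<in> U"
        consider "0 < bary U m v" | "bary U m v = 0" "v \<noteq> u"
          using nn[OF v] u(2) by fastforce
        then show "bary U m v > 0 \<or> bary U m v = 0 \<and> bary U u v > 0
          \<or> bary U m v = 0 \<and> bary U u v = 0 \<and> bary U p v > 0"
          using pU[OF v] bary_vertex[OF bU v u(1)] by cases auto
      qed
      show "\<forall>\<^sub>F e in at_right 0. (1 - e - e\<^sup>2) *\<^sub>R m + e *\<^sub>R u + e\<^sup>2 *\<^sub>R p \<in> interior (convex hull V)"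
        using m u(3) d0[OF u(1,2)] triangles_pos[OF Vd(1), of p] assms(2)
        by (intro eventually_perturb_interior[OF bV(2)]) (auto simp: V generic_def)
    qed
    moreover from this have "u = c"
      using u(1,3) bary_vertex[OF bV(2), of c u] V by (auto split: if_splits)
    ultimately show ?thesis
      using u(2) m by simp
  qed
qed

text \<open>Two boundary triangles at the edge \<open>{a, b}\<close> on the same side of the plane through \<open>a\<close>, \<open>b\<close>, \<open>p\<close> (with
  normal \<open>N\<close>) must be coplanar, so that their tetrahedra overlap near the midpoint of the edge.\<close>

lemma same_side_unique:
  assumes T: "(V, d) \<in> triangles" "(V', d') \<in> triangles"
    and V: "V = {a, b, c, d}" "a \<noteq> b" "c \<notin> {a, b}" "d \<notin> {a, b, c}"
    and V': "V' = {a, b, c', d'}" "c' \<notin> {a, b}" "d' \<notin> {a, b, c'}"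
    and p: "generic p"
    and N: "N \<bullet> b = N \<bullet> a" "N \<bullet> p = N \<bullet> a" "0 < (N \<bullet> c - N \<bullet> a) * (N \<bullet> c' - N \<bullet> a)"
  shows "(V, d) = (V', d')"
proof -
  have bV: "V \<in> \<V>" "affine_basis V" "V' \<in> \<V>" "affine_basis V'"
    using T basis by (auto simp: triangles_def)
  define g where "g = (\<lambda>x. N \<bullet> x - N \<bullet> a)"
  define L where "L = (\<lambda>x. bary V' x d')"
  have gx: "g x = bary V x c * g c + bary V x d * g d" for x
    using inner_bary_diff[OF bV(2), of N x "N \<bullet> a"] N unfolding sum_4[OF V] by (simp add: g_def)
  have Lx: "L x = bary V x c * L c + bary V x d * L d" for x
    using bary_comp[OF bV(2,4), of d' x] V' bary_vertex[OF bV(4)] unfolding sum_4[OF V] by (auto simp: L_def)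
  have pos: "0 < bary V p d" "0 < L p"
    using triangles_pos[OF T(1)] triangles_pos[OF T(2)] p by (auto simp: L_def generic_def)
  have "c \<in> W" "c' \<in> W"
    using V(1) V'(1) sub bV by auto
  then have nonneg: "0 \<le> bary V c' d" "0 \<le> L c"
    using triangles_nonneg[OF T(1) W_sub] triangles_nonneg[OF T(2) W_sub] by (auto simp: L_def)
  have "L c' = 0" "g p = 0"
    using V' bV by (auto simp: L_def bary_vertex g_def N)
  \<comment> \<open>The determinant of the coordinates of \<open>c'\<close> and \<open>p\<close>
    with respect to \<open>c\<close> and \<open>d\<close>. It is positive because \<open>c\<close>
    and \<open>c'\<close> are on the same side of the plane with normal \<open>N\<close>.\<close>
  define K where "K = bary V c' c * bary V p d - bary V c' d * bary V p c"
  have "g c * K = bary V p d * (bary V c' c * g c) - bary V c' d * (bary V p c * g c)"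
    by (simp add: K_def algebra_simps)
  also have "bary V p c * g c = - (bary V p d * g d)"
    using gx[of p] \<open>g p = 0\<close> by simp
  finally have "g c * K = bary V p d * g c'"
    by (simp add: gx[of c'] algebra_simps)
  then have "g c * g c * K = bary V p d * (g c * g c')"
    by (simp add: ac_simps)
  moreover have "0 < bary V p d * (g c * g c')"
    using pos N(3) by (simp add: g_def)
  ultimately have "0 < g c * g c * K"
    by (simp only:)
  then have "0 < K"
    using not_square_less_zero[of "g c"] zero_less_mult_iff[of "g c * g c" K] by blast
  \<comment> \<open>Eliminating \<open>L d\<close> gives a vanishing sum of two nonnegative terms,
    so \<open>c'\<close> lies in the plane of the first triangle.\<close>
  have "L c * K + bary V c' d * L p = bary V p d * L c'"
    unfolding K_def Lx[of p] Lx[of c'] by (simp add: algebra_simps)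
  then have "L c * K + bary V c' d * L p = 0"
    by (simp add: \<open>L c' = 0\<close>)
  then have "bary V c' d * L p = 0"
    using nonneg pos \<open>0 < K\<close> by (metis add_nonneg_eq_0_iff less_imp_le mult_nonneg_nonneg)
  then have z: "bary V c' d = 0"
    using pos by simp
  then have "0 < bary V c' c"
    using \<open>0 < K\<close> pos by (simp add: K_def zero_less_mult_iff)
  define m where "m = centroid {a, b}"
  have m: "bary U m v = (if v \<in> {a, b} then 1/2 else 0)" if "affine_basis U" "{a, b} \<subseteq> U" "v \<in> U" for U v
    using bary_centroid[OF that(1,2) _ that(3)] V(2) by (simp add: m_def)
  have "V = V'"
  proof (rule eventually_interior_unique[OF bV(1,3)])
    show "\<forall>\<^sub>F e in at_right 0. (1 - e - e\<^sup>2) *\<^sub>R m + e *\<^sub>R c' + e\<^sup>2 *\<^sub>R p \<in> interior (convex hull V)"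
    proof (rule eventually_perturb_interior[OF bV(2)])
      have "bary V m a = 1/2" "bary V m b = 1/2" "bary V m c = 0" "bary V m d = 0"
        using V(2-4) by (subst m[OF bV(2)]; force simp: V(1))+
      then show "bary V m v > 0 \<or> bary V m v = 0 \<and> bary V c' v > 0
          \<or> bary V m v = 0 \<and> bary V c' v = 0 \<and> bary V p v > 0" if "v \<in> V" for v
        using that z pos \<open>0 < bary V c' c\<close> unfolding V(1) by auto
    qed
    show "\<forall>\<^sub>F e in at_right 0. (1 - e - e\<^sup>2) *\<^sub>R m + e *\<^sub>R c' + e\<^sup>2 *\<^sub>R p \<in> interior (convex hull V')"
    proof (rule eventually_perturb_interior[OF bV(4)])
      have "bary V' m a = 1/2" "bary V' m b = 1/2" "bary V' m c' = 0" "bary V' m d' = 0"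
        using V'(2,3) V(2) by (subst m[OF bV(4)]; force simp: V'(1))+
      moreover have "bary V' c' c' = 1" "bary V' c' d' = 0" "0 < bary V' p d'"
        using V'(2,3) pos(2) bary_vertex[OF bV(4), of c' c'] bary_vertex[OF bV(4), of d' c']
        by (auto simp: L_def V'(1))
      ultimately show "bary V' m v > 0 \<or> bary V' m v = 0 \<and> bary V' c' v > 0
          \<or> bary V' m v = 0 \<and> bary V' c' v = 0 \<and> bary V' p v > 0" if "v \<in> V'" for v
        using that unfolding V'(1) by auto
    qed
  qed
  moreover from this have "c' = c"
  proof -
    have "c \<in> V" "c' \<in> V"
      using V(1) V'(1) \<open>V = V'\<close> by blast+
    then show ?thesis
      using \<open>0 < bary V c' c\<close> bary_vertex[OF bV(2), of c c'] by (auto split: if_splits)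
  qed
  moreover have "V - {a, b, c} = {d}" "V' - {a, b, c'} = {d'}"
    using V V' by blast+
  ultimately show ?thesis
    by simp
qed

text \<open>The third vertex of a boundary triangle at \<open>e\<close> is off the plane through
  \<open>e\<close> and \<open>p\<close>, and each side of this plane admits at most one
  triangle.\<close>

lemma card_triangles_at_edge:
  assumes "e \<in> pairs W"
  shows "card {t \<in> triangles. e \<subseteq> fst t - {snd t}} \<le> 2"
proof -
  obtain p where p: "generic p"
    using generic_exists[OF open_interior interior_nonempty interior_subset] by blast
  obtain a b where e: "e = {a, b}" "a \<noteq> b"
    using assms by (auto simp: pairs_def card_2_iff)
  obtain N where N: "N \<noteq> 0" "N \<bullet> (b - a) = 0" "N \<bullet> (p - a) = 0"
    using exists_normal .
  have N': "N \<bullet> b = N \<bullet> a" "N \<bullet> p = N \<bullet> a"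
    using N by (auto simp: inner_diff_right)
  let ?I = "{t \<in> triangles. e \<subseteq> fst t - {snd t}}"
  let ?g = "\<lambda>t. \<exists>c \<in> fst t - {snd t}. N \<bullet> c > N \<bullet> a"
  have third: "\<exists>c. V = {a, b, c, d} \<and> c \<notin> {a, b} \<and> d \<notin> {a, b, c} \<and> N \<bullet> c \<noteq> N \<bullet> a \<and> (?g (V, d) \<longleftrightarrow> N \<bullet> c > N \<bullet> a)"
    if t: "(V, d) \<in> ?I" for V d
  proof -
    obtain c where V: "V = {a, b, c, d}" "c \<notin> {a, b}" "d \<notin> {a, b, c}"
      using edgeE[of e V d a b] t e by auto
    have bV: "V \<in> \<V>" "affine_basis V"
      using t basis by (auto simp: triangles_def)
    have gx: "N \<bullet> x - N \<bullet> a = bary V x c * (N \<bullet> c - N \<bullet> a) + bary V x d * (N \<bullet> d - N \<bullet> a)" for x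
      using inner_bary_diff[OF bV(2), of N x "N \<bullet> a"] N' unfolding sum_4[OF V(1) e(2) V(2,3)] by simp
    have "bary V p d \<noteq> 0"
      using p bV V by (auto simp: generic_def)
    have "N \<bullet> c \<noteq> N \<bullet> a"
    proof
      assume "N \<bullet> c = N \<bullet> a"
      moreover from this have "N \<bullet> d = N \<bullet> a"
        using gx[of p] N' \<open>bary V p d \<noteq> 0\<close> by simp
      ultimately show False
        using inner_not_const[OF bV(2) N(1), of "N \<bullet> a"] N' V by auto
    qed
    then show ?thesis
      using V N' by (intro exI[of _ c]) auto
  qed
  have "inj_on ?g ?I"
  proof (rule inj_onI)
    fix t t' assume tt: "t \<in> ?I" "t' \<in> ?I" "?g t \<longleftrightarrow> ?g t'"
    obtain V d V' d' where eq: "t = (V, d)" "t' = (V', d')"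
      by (cases t, cases t')
    obtain c where c: "V = {a, b, c, d}" "c \<notin> {a, b}" "d \<notin> {a, b, c}"
        "N \<bullet> c \<noteq> N \<bullet> a" "?g t \<longleftrightarrow> N \<bullet> c > N \<bullet> a"
      using third[of V d] tt(1) unfolding eq by blast
    obtain c' where c': "V' = {a, b, c', d'}" "c' \<notin> {a, b}" "d' \<notin> {a, b, c'}"
        "N \<bullet> c' \<noteq> N \<bullet> a" "?g t' \<longleftrightarrow> N \<bullet> c' > N \<bullet> a"
      using third[of V' d'] tt(2) unfolding eq by blast
    have "0 < (N \<bullet> c - N \<bullet> a) * (N \<bullet> c' - N \<bullet> a)"
      using c(4,5) c'(4,5) tt(3) unfolding zero_less_mult_iff by linarith
    then show "t = t'"
      using same_side_unique[OF _ _ c(1) e(2) c(2,3) c'(1-3) p N'] tt(1,2) unfolding eq by blast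
  qed
  then have "card ?I \<le> card (UNIV :: bool set)"
    by (rule card_inj_on_le) auto
  then show ?thesis
    by simp
qed

text \<open>Incidences are counted twice: three edges per triangle, at most two triangles per
  edge.\<close>

lemma triangles_edges: "3 * card triangles \<le> 2 * card edges"
proof -
  have "card {e \<in> edges. e \<subseteq> fst t - {snd t}} = 3" if t0: "t \<in> triangles" for t
  proof -
    obtain V d where t: "t = (V, d)" "V \<in> \<V>" "d \<in> V"
      using t0 by (auto simp: triangles_def)
    have "{e \<in> edges. e \<subseteq> fst t - {snd t}} = pairs (V - {d})"
      using t0 t sub[OF t(2)] by (auto simp: edges_def pairs_def)
    moreover have "card (V - {d}) = 3" "finite (V - {d})"
      using card_V[OF t(2)] t(3) finite_V[OF t(2)] by auto
    ultimately show ?thesis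
      by (simp add: card_pairs choose_two)
  qed
  then have "3 * card triangles = (\<Sum>t\<in>triangles. card {e \<in> edges. e \<subseteq> fst t - {snd t}})"
    by simp
  also have "\<dots> = (\<Sum>e\<in>edges. card {t \<in> triangles. e \<subseteq> fst t - {snd t}})"
    by (rule sum_card_swap[OF finite_triangles finite_edges])
  also have "\<dots> \<le> (\<Sum>e\<in>edges. 2)"
    by (intro sum_mono card_triangles_at_edge) (auto simp: edges_def)
  finally show ?thesis
    by simp
qed

section \<open>Counting boundary triangles by a sweep in direction \<open>h\<close>\<close>

lemma exists_injective_functional:
  obtains h where "inj_on ((\<bullet>) h) W"
proof -
  let ?F = "(\<lambda>(x,y). {z. (x - y) \<bullet> z = 0}) ` {(x,y) \<in> W \<times> W. x \<noteq> y}"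
  have "finite {(x,y) \<in> W \<times> W. x \<noteq> y}"
    by (rule finite_subset[of _ "W \<times> W"]) (auto simp: finite_W)
  then have "finite ?F"
    by simp
  moreover have "closed F \<and> interior F = {}" if "F \<in> ?F" for F
    using that by (auto simp: closed_hyperplane)
  ultimately obtain h where h: "\<And>F. F \<in> ?F \<Longrightarrow> h \<notin> F"
    using avoid_nowhere_dense[of ?F UNIV] by auto
  have "inj_on ((\<bullet>) h) W"
  proof (rule inj_onI, rule ccontr)
    fix x y assume xy: "x \<in> W" "y \<in> W" "h \<bullet> x = h \<bullet> y" "x \<noteq> y"
    then have "{z. (x - y) \<bullet> z = 0} \<in> ?F"
      by (intro image_eqI[of _ _ "(x, y)"]) auto
    from h[OF this] show False
      using xy(3) by (simp add: inner_commute[of "x - y" h] inner_diff_right)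
  qed
  then show ?thesis
    using that by blast
qed

definition median :: "real^3 \<Rightarrow> real^3 \<Rightarrow> ((real^3) set \<times> (real^3)) set" where
  "median h v = {t \<in> triangles. v \<in> fst t - {snd t} \<and> (\<exists>b\<in>fst t - {snd t}. \<exists>c\<in>fst t - {snd t}. h \<bullet> b < h \<bullet> v \<and> h \<bullet> v < h \<bullet> c)}"

text \<open>Each of \<open>v\<close> and \<open>v'\<close> would have its height strictly between
  those of the other and of the third vertex.\<close>

lemma median_unique:
  assumes "t \<in> median h v" "t \<in> median h v'"
  shows "v = v'"
proof (rule ccontr)
  assume ne: "v \<noteq> v'"
  let ?A = "fst t - {snd t}"
  have "card ?A = 3" "finite ?A"
    using assms(1) card_V[of "fst t"] finite_V[of "fst t"] by (auto simp: median_def triangles_def)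
  moreover have "v \<in> ?A" "v' \<in> ?A"
    using assms by (auto simp: median_def)
  ultimately have "card (?A - {v, v'}) = 1"
    using ne by (simp add: card_Diff_subset)
  then obtain x where "?A - {v, v'} = {x}"
    by (auto simp: card_1_singleton_iff)
  then have A: "?A = {v, v', x}"
    using \<open>v \<in> ?A\<close> \<open>v' \<in> ?A\<close> by blast
  have "\<exists>b\<in>?A. \<exists>c\<in>?A. h \<bullet> b < h \<bullet> v \<and> h \<bullet> v < h \<bullet> c"
    and "\<exists>b\<in>?A. \<exists>c\<in>?A. h \<bullet> b < h \<bullet> v' \<and> h \<bullet> v' < h \<bullet> c"
    using assms unfolding median_def by blast+
  then show False
    unfolding A by auto
qed

lemma finite_median: "finite (median h v)"
  using finite_triangles by (simp add: median_def)

text \<open>The functional \<open>g\<close> exposes the vertex \<open>v\<close>, and \<open>x0\<close> lies close to \<open>v\<close> in the section of \<open>P\<close> at the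
  height \<open>h \<bullet> v\<close>. The ray from \<open>x0\<close> inside this section leaves \<open>P\<close> through a triangle at \<open>v\<close>, and
  since \<open>h\<close> is injective, that triangle crosses the height of \<open>v\<close>.\<close>

lemma median_in_direction:
  assumes v: "v \<in> W" and h: "inj_on ((\<bullet>) h) W"
    and g: "\<And>w. w \<in> W \<Longrightarrow> w \<noteq> v \<Longrightarrow> \<beta> < g \<bullet> w" "g \<bullet> x0 < \<beta>"
    and x0: "x0 \<in> interior P" "x0 \<noteq> v" "h \<bullet> x0 = h \<bullet> v" "g \<bullet> v < g \<bullet> x0"
    and l: "l \<noteq> 0" "h \<bullet> l = 0" "g \<bullet> l = 0"
  obtains V d t where "(V, d) \<in> median h v" "0 < t" "bary V (x0 + t *\<^sub>R l) d = 0"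
proof -
  have "bounded P" "closed P"
    using finite_W by (simp_all add: finite_imp_bounded_convex_hull compact_imp_closed finite_imp_compact_convex_hull)
  then obtain t where t: "0 < t" "x0 + t *\<^sub>R l \<in> frontier P"
    using ray_to_frontier[OF _ x0(1) l(1)] by metis
  define x where "x = x0 + t *\<^sub>R l"
  have xP: "x \<in> P" "x \<notin> interior P"
    using t \<open>closed P\<close> by (auto simp: x_def frontier_def)
  have gx: "g \<bullet> x = g \<bullet> x0" "h \<bullet> x = h \<bullet> v"
    using l x0 by (auto simp: x_def inner_add_right)
  obtain V where V: "V \<in> \<V>" "x \<in> convex hull V"
    using xP(1) cover by blast
  have bV: "affine_basis V" by (rule basis[OF V(1)])
  have fin: "finite V" by (rule finite_V[OF V(1)])
  have nn: "0 \<le> bary V x u" if "u \<in> V" for u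
    using V(2) that by (simp add: convex_hull_bary[OF bV])
  \<comment> \<open>The value of \<open>g\<close> at \<open>x\<close> is below
    \<open>\<beta>\<close>, and \<open>v\<close> is the only vertex that can pull it there.\<close>
  have vV: "v \<in> V" "0 < bary V x v"
  proof -
    have "(\<Sum>u\<in>V. bary V x u * (g \<bullet> u - \<beta>)) < 0"
      using inner_bary_diff[OF bV, of g x \<beta>] gx g(2) by simp
    then obtain u where u: "u \<in> V" "bary V x u * (g \<bullet> u - \<beta>) < 0"
      by (meson not_less sum_nonneg)
    then have "u = v" "0 < bary V x u"
      using g(1)[of u] nn[of u] sub[OF V(1)] by (fastforce simp: mult_less_0_iff)+
    then show "v \<in> V" "0 < bary V x v"
      using u by auto
  qed
  have "\<exists>u\<in>V. u \<noteq> v \<and> bary V x u \<noteq> 0"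
  proof (rule ccontr)
    assume "\<not> ?thesis"
    then have "x = v"
      by (intro bary_single_support[OF bV vV(1)]) auto
    then show False
      using gx x0 by simp
  qed
  then obtain u where u: "u \<in> V" "u \<noteq> v" "bary V x u \<noteq> 0"
    by blast
  then have "h \<bullet> u \<noteq> h \<bullet> v"
    using inj_onD[OF h] v sub[OF V(1)] by blast
  have sum0: "(\<Sum>u\<in>V. bary V x u * (h \<bullet> u - h \<bullet> v)) = 0"
    using inner_bary_diff[OF bV, of h x "h \<bullet> v"] gx by simp
  \<comment> \<open>The weighted heights relative to \<open>v\<close> sum to 0 but do not all
    vanish, so both signs occur.\<close>
  have "\<exists>c\<in>V. 0 < bary V x c * (h \<bullet> c - h \<bullet> v)"
  proof (rule ccontr)
    assume "\<not> ?thesis"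
    then have "(\<Sum>u\<in>V. bary V x u * (h \<bullet> u - h \<bullet> v)) < (\<Sum>u\<in>V. 0)"
      using u \<open>h \<bullet> u \<noteq> h \<bullet> v\<close> fin
      by (intro sum_strict_mono_ex1) (auto simp: not_less intro!: bexI[of _ u] order_neq_le_trans)
    then show False using sum0 by simp
  qed
  then obtain c where c: "c \<in> V" "0 < bary V x c" "h \<bullet> v < h \<bullet> c"
    using nn by (fastforce simp: zero_less_mult_iff)
  have "\<exists>b\<in>V. bary V x b * (h \<bullet> b - h \<bullet> v) < 0"
  proof (rule ccontr)
    assume "\<not> ?thesis"
    then have "(\<Sum>u\<in>V. 0) < (\<Sum>u\<in>V. bary V x u * (h \<bullet> u - h \<bullet> v))"
      using u \<open>h \<bullet> u \<noteq> h \<bullet> v\<close> fin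
      by (intro sum_strict_mono_ex1) (auto simp: not_less intro!: bexI[of _ u] order_neq_le_trans)
    then show False using sum0 by simp
  qed
  then obtain b where b: "b \<in> V" "0 < bary V x b" "h \<bullet> b < h \<bullet> v"
    using nn by (fastforce simp: mult_less_0_iff)
  have "x \<notin> interior (convex hull V)"
    using xP(2) interior_mono[OF hull_sub[OF V(1)]] by blast
  then obtain d where d: "d \<in> V" "bary V x d = 0"
    using nn by (force simp: interior_convex_hull_bary[OF bV])
  have "d \<notin> {v, b, c}" "b \<noteq> v" "c \<noteq> v" "b \<noteq> c"
    using d vV b c by auto
  have Veq: "V = {v, b, c, d}"
  proof (rule sym, rule card_subset_eq[OF fin])
    show "{v, b, c, d} \<subseteq> V"
      using vV b c d by auto
    show "card {v, b, c, d} = card V"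
      using card_V[OF V(1)] \<open>d \<notin> {v, b, c}\<close> \<open>b \<noteq> v\<close> \<open>c \<noteq> v\<close> \<open>b \<noteq> c\<close> by auto
  qed
  obtain f where f: "f \<noteq> 0" "\<And>y. y \<in> P \<Longrightarrow> f \<bullet> y \<le> f \<bullet> x"
    using supporting_functional[OF convex_convex_hull interior_nonempty xP(2)] by blast
  have VP: "y \<in> P" if "y \<in> V" for y
    using sub[OF V(1)] that W_sub by blast
  \<comment> \<open>Being constant on \<open>v\<close>, \<open>b\<close>, \<open>c\<close>, the
    supporting functional differs from \<open>f \<bullet> x\<close> by a multiple of the coordinate
    of \<open>d\<close>. This puts the facet opposite \<open>d\<close> into the boundary.\<close>
  have "f \<bullet> u = f \<bullet> x" if "u \<in> {v, b, c}" for u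
    using tight_support[OF bV V(2), of f u] f(2)[OF VP] vV b c that by auto
  then have fy: "f \<bullet> y - f \<bullet> x = bary V y d * (f \<bullet> d - f \<bullet> x)" for y
    using inner_bary_diff[OF bV, of f y "f \<bullet> x"] \<open>d \<notin> {v, b, c}\<close> \<open>b \<noteq> v\<close> \<open>c \<noteq> v\<close> \<open>b \<noteq> c\<close>
    by (subst (asm) sum_4[OF Veq]) auto
  have "f \<bullet> d \<noteq> f \<bullet> x"
    using inner_not_const[OF bV f(1), of "f \<bullet> x"] fy by fastforce
  then have "f \<bullet> d < f \<bullet> x"
    using f(2)[OF VP[OF d(1)]] by simp
  then have "0 \<le> bary V y d" if "y \<in> W" for y
    using fy[of y] f(2)[OF W_sub[OF that]] by (smt (verit) mult_neg_neg)
  then have "(V, d) \<in> triangles"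
    using V(1) d(1) by (simp add: triangles_def)
  then have "(V, d) \<in> median h v"
    using b c vV(1) \<open>d \<notin> {v, b, c}\<close> by (auto simp: median_def)
  then show ?thesis
    using that t(1) d(2) by (simp add: x_def)
qed

text \<open>The rays from \<open>x0\<close> in the directions \<open>l\<close> and \<open>-l\<close>
  each yield a triangle. If the two were the same, its plane would contain the interior point
  \<open>x0\<close> between the two exit points.\<close>

lemma two_medians:
  assumes v: "v \<in> W" and h: "inj_on ((\<bullet>) h) W"
    and lo: "lo \<in> W" "h \<bullet> lo < h \<bullet> v" and hi: "hi \<in> W" "h \<bullet> v < h \<bullet> hi"
  shows "2 \<le> card (median h v)"
proof -
  have cv: "convex P" by simp
  obtain q where q: "q \<in> interior P"
    using interior_nonempty by blast
  obtain p where p: "p \<in> interior P" "h \<bullet> p = h \<bullet> v"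
  proof -
    \<comment> \<open>The height of \<open>v\<close> separates \<open>w\<close> from
      \<open>q\<close> or equals that of \<open>q\<close>, so the segment from \<open>w\<close> to
      \<open>q\<close> passes this height at an interior point.\<close>
    obtain w where w: "w \<in> W" "(h \<bullet> w < h \<bullet> v \<and> h \<bullet> v \<le> h \<bullet> q) \<or> (h \<bullet> v < h \<bullet> w \<and> h \<bullet> q \<le> h \<bullet> v)"
      using lo hi by (meson linear)
    define e where "e = (h \<bullet> v - h \<bullet> w) / (h \<bullet> q - h \<bullet> w)"
    have "h \<bullet> q - h \<bullet> w \<noteq> 0" "0 < e" "e \<le> 1"
      using w(2) by (auto simp: e_def divide_simps)
    moreover have "h \<bullet> (w - e *\<^sub>R (w - q)) = h \<bullet> w + e * (h \<bullet> q - h \<bullet> w)"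
      by (simp add: inner_diff_right algebra_simps)
    then have "h \<bullet> (w - e *\<^sub>R (w - q)) = h \<bullet> v"
      using \<open>h \<bullet> q - h \<bullet> w \<noteq> 0\<close> by (simp add: e_def)
    ultimately show ?thesis
      using that[OF mem_interior_convex_shrink[OF cv q W_sub[OF w(1)]]] by blast
  qed
  have "v \<notin> convex hull (W - {v})"
  proof -
    have "convex (P - {v})"
      using extreme[OF v] by (simp add: extreme_point_of_stillconvex)
    moreover have "W - {v} \<subseteq> P - {v}"
      using W_sub by auto
    ultimately have "convex hull (W - {v}) \<subseteq> P - {v}"
      by (intro hull_minimal)
    then show ?thesis
      by blast
  qed
  moreover have "closed (convex hull (W - {v}))"
    using finite_W by (simp add: compact_imp_closed finite_imp_compact_convex_hull)
  ultimately obtain g \<beta> where g: "g \<bullet> v < \<beta>" "\<forall>x\<in>convex hull (W - {v}). \<beta> < g \<bullet> x"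
    using separating_hyperplane_closed_point[OF convex_convex_hull] by blast
  have gW: "\<beta> < g \<bullet> w" if "w \<in> W" "w \<noteq> v" for w
    using g(2) that by (simp add: hull_inc)
  have "g \<bullet> v < g \<bullet> p"
  proof -
    have "(- g) \<bullet> p < - (g \<bullet> v)"
    proof (rule inner_less_interior[OF p(1)])
      have "lo \<noteq> v" using lo by auto
      then show "- g \<noteq> 0"
        using gW[OF lo(1)] g(1) by auto
      have "W \<subseteq> {y. g \<bullet> v \<le> g \<bullet> y}"
        using gW g(1) by fastforce
      then have "P \<subseteq> {y. g \<bullet> v \<le> g \<bullet> y}"
        by (rule hull_minimal) (rule convex_halfspace_ge)
      then show "(- g) \<bullet> y \<le> - (g \<bullet> v)" if "y \<in> P" for y
        using that by auto
    qed
    then show ?thesis by simp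
  qed
  have "((\<lambda>s. g \<bullet> (v - s *\<^sub>R (v - p))) \<longlongrightarrow> g \<bullet> (v - 0 *\<^sub>R (v - p))) (at_right 0)"
    by (intro tendsto_intros)
  then have "\<forall>\<^sub>F s in at_right 0. g \<bullet> (v - s *\<^sub>R (v - p)) < \<beta>"
    by (rule order_tendstoD(2)) (use g(1) in simp)
  moreover have "\<forall>\<^sub>F s in at_right (0::real). 0 < s \<and> s < 1"
    by (auto simp: eventually_at_right_field intro: exI[of _ 1])
  ultimately have "\<forall>\<^sub>F s in at_right 0. g \<bullet> (v - s *\<^sub>R (v - p)) < \<beta> \<and> 0 < s \<and> s < 1"
    by (rule eventually_conj)
  then obtain s where s: "g \<bullet> (v - s *\<^sub>R (v - p)) < \<beta>" "0 < s" "s < 1"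
    using eventually_happens'[OF trivial_limit_at_right_real] by blast
  define x0 where "x0 = v - s *\<^sub>R (v - p)"
  have x0: "x0 \<in> interior P"
    unfolding x0_def using s by (intro mem_interior_convex_shrink[OF cv p(1) W_sub[OF v]]) auto
  have hx0: "h \<bullet> x0 = h \<bullet> v" and gx0: "g \<bullet> v < g \<bullet> x0"
    using p(2) s \<open>g \<bullet> v < g \<bullet> p\<close> by (simp_all add: x0_def inner_diff_right mult_less_0_iff)
  have "x0 \<noteq> v"
    using gx0 by auto
  obtain l where l: "l \<noteq> 0" "l \<bullet> h = 0" "l \<bullet> g = 0"
    using exists_normal .
  then have l': "h \<bullet> l = 0" "g \<bullet> l = 0"
    by (simp_all add: inner_commute)
  obtain V d t where t: "(V, d) \<in> median h v" "0 < t" "bary V (x0 + t *\<^sub>R l) d = 0"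
    using median_in_direction[OF v h gW s(1)[folded x0_def] x0 \<open>x0 \<noteq> v\<close> hx0 gx0 l(1) l'] .
  obtain V' d' t' where t': "(V', d') \<in> median h v" "0 < t'" "bary V' (x0 + t' *\<^sub>R (- l)) d' = 0"
    using median_in_direction[OF v h gW s(1)[folded x0_def] x0 \<open>x0 \<noteq> v\<close> hx0 gx0, of "- l"] l(1) l' by auto
  have "(V, d) \<noteq> (V', d')"
  proof
    assume eq: "(V, d) = (V', d')"
    have tr: "(V, d) \<in> triangles"
      using t(1) by (simp add: median_def)
    then have V: "affine_basis V" "d \<in> V"
      using basis by (auto simp: triangles_def)
    \<comment> \<open>The weights are chosen to cancel \<open>l\<close>, so the combination is
      \<open>x0\<close>.\<close>
    have "bary V ((t' / (t + t')) *\<^sub>R (x0 + t *\<^sub>R l) + (t / (t + t')) *\<^sub>R (x0 + t' *\<^sub>R (- l))) d = 0"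
      using t t' eq by (subst bary_affine[OF V(1) _ V(2)]) (auto simp: divide_simps)
    moreover have "(t' / (t + t')) *\<^sub>R (x0 + t *\<^sub>R l) + (t / (t + t')) *\<^sub>R (x0 + t' *\<^sub>R (- l))
        = (t' / (t + t') + t / (t + t')) *\<^sub>R x0"
      by (simp add: algebra_simps)
    moreover have "t' / (t + t') + t / (t + t') = 1"
      using t(2) t'(2) by (simp add: divide_simps)
    ultimately show False
      using triangles_pos[OF tr x0] by simp
  qed
  then have "card {(V, d), (V', d')} = 2"
    by simp
  then show ?thesis
    using finite_median t(1) t'(1) card_mono[of "median h v" "{(V, d), (V', d')}"] by simp
qed

text \<open>All vertices but the lowest and the highest lie in \<open>M\<close>, and their families
  of triangles are disjoint.\<close>

lemma card_triangles_ge: "2 * (card W - 2) \<le> card triangles"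
proof -
  obtain h where h: "inj_on ((\<bullet>) h) W"
    using exists_injective_functional .
  define M where "M = {v \<in> W. (\<exists>lo\<in>W. h \<bullet> lo < h \<bullet> v) \<and> (\<exists>hi\<in>W. h \<bullet> v < h \<bullet> hi)}"
  let ?A = "{v \<in> W. \<forall>w\<in>W. h \<bullet> v \<le> h \<bullet> w}" and ?B = "{v \<in> W. \<forall>w\<in>W. h \<bullet> w \<le> h \<bullet> v}"
  have "card ?A \<le> 1" "card ?B \<le> 1"
    using finite_W by (auto simp: card_le_Suc0_iff_eq intro!: inj_onD[OF h] antisym[of "_ \<bullet> _"])
  then have "card (?A \<union> ?B) \<le> 2"
    using card_Un_le[of ?A ?B] by linarith
  moreover have "W \<subseteq> M \<union> (?A \<union> ?B)"
    by (auto simp: M_def not_le)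
  then have "card W \<le> card (M \<union> (?A \<union> ?B))"
    using finite_W by (intro card_mono) (auto simp: M_def)
  then have "card W \<le> card M + card (?A \<union> ?B)"
    using card_Un_le[of M "?A \<union> ?B"] by linarith
  ultimately have "2 * (card W - 2) \<le> (\<Sum>v\<in>M. 2)"
    by simp
  also have "\<dots> \<le> (\<Sum>v\<in>M. card (median h v))"
    by (intro sum_mono) (auto simp: M_def intro: two_medians[OF _ h])
  also have "\<dots> = card (\<Union>v\<in>M. median h v)"
    using finite_W by (intro card_UN_disjoint[symmetric]) (auto simp: M_def finite_median dest: median_unique)
  also have "\<dots> \<le> card triangles"
    by (intro card_mono finite_triangles) (auto simp: median_def)
  finally show ?thesis .
qed

lemma card_edges_ge: "3 * card W \<le> card edges + 6"
  using card_triangles_ge triangles_edges by linarith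

subsection \<open>The two bounds\<close>

lemma card_W_ge: "4 \<le> card W"
proof -
  have "P \<noteq> {}"
    using interior_nonempty interior_subset by blast
  then obtain V where "V \<in> \<V>"
    using cover by blast
  then show ?thesis
    using card_mono[OF finite_W sub] card_V by metis
qed

lemma upper_bound: "card \<V> \<le> (card W - 2) choose 2"
proof -
  obtain p where p: "generic p"
    using generic_exists[OF open_interior interior_nonempty interior_subset] by blast
  \<comment> \<open>With \<open>card edges\<close> added, every pair contributes at most 2, since
    boundary edges are never counted by \<open>away\<close>.\<close>
  have "2 * card \<V> + card W + card edges =
      (\<Sum>e\<in>pairs W. card (towards p e) + card (away p e)) + card {e \<in> pairs W. e \<in> edges}"
    unfolding double_count[OF p] by (auto simp: edges_def intro: arg_cong[where f = card])
  also have "\<dots> = (\<Sum>e\<in>pairs W. card (towards p e) + card (away p e) + (if e \<in> edges then 1 else 0))"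
    by (simp add: sum.distrib card_eq_sum sum.inter_filter[OF finite_pairs[OF finite_W]] del: sum_constant One_nat_def)
  also have "\<dots> \<le> (\<Sum>e\<in>pairs W. 2)"
  proof (rule sum_mono)
    fix e assume "e \<in> pairs W"
    then have "e \<noteq> {}" by (rule pairs_nonempty)
    then show "card (towards p e) + card (away p e) + (if e \<in> edges then 1 else 0) \<le> 2"
      using card_towards_le[of e p] card_away_le[of e p] away_empty[of e p] edge_not_interior[of e] p
      by (auto simp: generic_def)
  qed
  also have "\<dots> = card W * (card W - 1)"
    by (simp add: card_pairs[OF finite_W] times_binomial_minus1_eq[of 2, simplified] mult.commute[of _ 2])
  finally have "2 * card \<V> + card W + card edges \<le> card W * (card W - 1)" .
  moreover obtain k where k: "card W = k + 3"
    using card_W_ge by (metis add.commute le_Suc_ex numeral_3_eq_3 Suc_leD eval_nat_numeral(2) semiring_norm(26,27,28))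
  ultimately have "2 * card \<V> + (k + 3) + (3 * k + 3) \<le> (k + 3) * (k + 2)"
    using card_edges_ge by simp
  then have "2 * card \<V> \<le> (k + 1) * k"
    by (simp add: algebra_simps)
  then show ?thesis
    by (simp add: k choose_two)
qed

text \<open>For \<open>p\<close> inside \<open>V\<close> all coordinates are positive, so
  \<open>V\<close> counts \<open>e\<close> in addition to the counted boundary edges.\<close>

lemma lower_bound:
  assumes V: "V \<in> \<V>" "e \<in> pairs V" "centroid e \<in> interior P"
  shows "card W - 2 \<le> card \<V>"
proof -
  obtain p where p: "p \<in> interior (convex hull V)" "generic p"
    using generic_exists[OF open_interior interior_convex_hull_affine_basis_nonempty[OF basis[OF V(1)]]]
      hull_sub[OF V(1)] interior_subset by (metis subset_trans)
  have "V \<in> towards p e"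
    using V p(1) by (auto simp: towards_def pairs_def interior_convex_hull_bary[OF basis[OF V(1)]])
  then have *: "0 < card (towards p e')" if "e' \<in> insert e edges" for e'
    using that edge_towards[OF _ p(2)] finite_towards by (auto simp: card_gt_0_iff)
  have "e \<notin> edges"
    using edge_not_interior V(3) by blast
  then have "card edges + 1 = (\<Sum>e'\<in>insert e edges. 1)"
    using finite_edges by simp
  also have "\<dots> \<le> (\<Sum>e'\<in>insert e edges. card (towards p e') + card (away p e'))"
    using * by (intro sum_mono) (simp add: Suc_leI trans_le_add1)
  also have "\<dots> \<le> (\<Sum>e'\<in>pairs W. card (towards p e') + card (away p e'))"
    using V(2) sub[OF V(1)] by (intro sum_mono2 finite_pairs finite_W) (auto simp: edges_def pairs_def)
  also have "\<dots> = 2 * card \<V> + card W"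
    by (rule double_count[OF p(2), symmetric])
  \<comment> \<open>With n = \<open>card W\<close> and f = \<open>card \<V>\<close> this is 3n - 5
    \<le> 2f + n, so 2f \<ge> 2n - 5, and f \<ge> n - 2 by parity.\<close>
  finally show ?thesis
    using card_edges_ge by linarith
qed

subsection \<open>Mismatches force an interior edge\<close>

text \<open>A supporting plane at the midpoint contains both ends, hence the whole segment.\<close>

lemma pair_hull_not_interior:
  assumes e: "e \<in> pairs W" "centroid e \<notin> interior P" and x: "x \<in> convex hull e"
  shows "x \<notin> interior P"
proof
  assume xi: "x \<in> interior P"
  obtain a b where ab: "e = {a, b}" "a \<noteq> b"
    using e by (auto simp: pairs_def card_2_iff)
  obtain f where f: "f \<noteq> 0" "\<And>y. y \<in> P \<Longrightarrow> f \<bullet> y \<le> f \<bullet> centroid e"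
    using supporting_functional[OF convex_convex_hull interior_nonempty e(2)] by blast
  have "f \<bullet> centroid e = (f \<bullet> a + f \<bullet> b) / 2"
    using ab by (simp add: centroid_def inner_add_right)
  moreover have "f \<bullet> a \<le> f \<bullet> centroid e" "f \<bullet> b \<le> f \<bullet> centroid e"
    using f(2) W_sub e(1) ab by (auto simp: pairs_def)
  ultimately have "e \<subseteq> {y. f \<bullet> y = f \<bullet> centroid e}"
    using ab by auto
  then have "convex hull e \<subseteq> {y. f \<bullet> y = f \<bullet> centroid e}"
    by (intro hull_minimal convex_hyperplane)
  then show False
    using x inner_less_interior[OF xi f] by auto
qed

text \<open>Let \<open>x\<close> be common to two tetrahedra, separated by a plane. If \<open>x\<close> is on the boundary of \<open>P\<close>, then
  three vertices lie both in that plane and in a supporting plane at \<open>x\<close>, which cannot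
  coincide. Otherwise \<open>x\<close> is inside a triangle of \<open>V\<close> in that plane, and the segment from \<open>x\<close> to
  \<open>u\<close> would leave this triangle through an edge in the interior of \<open>P\<close>.\<close>

lemma support_subset:
  assumes front: "\<And>V e. V \<in> \<V> \<Longrightarrow> e \<in> pairs V \<Longrightarrow> centroid e \<notin> interior P"
    and UV: "U \<in> \<V>" "V \<in> \<V>" "U \<noteq> V"
    and x: "x \<in> convex hull U" "x \<in> convex hull V"
    and u: "u \<in> U" "0 < bary U x u"
  shows "u \<in> V"
proof (rule ccontr)
  assume "u \<notin> V"
  note bU = basis[OF UV(1)] and bV = basis[OF UV(2)]
  have uW: "u \<in> W"
    using u sub UV by blast
  obtain a b where a: "a \<noteq> 0" "\<And>y. y \<in> convex hull U \<Longrightarrow> a \<bullet> y \<le> b" "\<And>y. y \<in> convex hull V \<Longrightarrow> b \<le> a \<bullet> y"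
    using separating_functional[OF convex_convex_hull interior_convex_hull_affine_basis_nonempty[OF bU]
      convex_convex_hull interior_convex_hull_affine_basis_nonempty[OF bV] disjoint[OF UV]] by metis
  have ax: "a \<bullet> x = b"
    using a(2)[OF x(1)] a(3)[OF x(2)] by simp
  have aU: "a \<bullet> v = b" if "v \<in> U" "0 < bary U x v" for v
    using tight_support[OF bU x(1) _ that, of a] a(2) ax by (simp add: hull_inc)
  have aV: "a \<bullet> v = b" if "v \<in> V" "0 < bary V x v" for v
    using tight_support[OF bV x(2) _ that, of "- a"] a(3) ax by (simp add: hull_inc)
  have nnV: "0 \<le> bary V x v" if "v \<in> V" for v
    using x(2) that by (simp add: convex_hull_bary[OF bV])
  show False
  proof (cases "x \<in> interior P")
    case False
    obtain f where f: "f \<noteq> 0" "\<And>y. y \<in> P \<Longrightarrow> f \<bullet> y \<le> f \<bullet> x"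
      using supporting_functional[OF convex_convex_hull interior_nonempty False] by blast
    have fU: "f \<bullet> v = f \<bullet> x" if "v \<in> U" "0 < bary U x v" for v
      using tight_support[OF bU x(1) _ that, of f] f(2) W_sub sub UV by blast
    have fV: "f \<bullet> v = f \<bullet> x" if "v \<in> V" "0 < bary V x v" for v
      using tight_support[OF bV x(2) _ that, of f] f(2) W_sub sub UV by blast
    have "\<exists>c\<in>V. 0 < bary V x c"
      using sum_bary[OF bV, of x] sum_nonpos[of V "bary V x"] by force
    then obtain c where c: "c \<in> V" "0 < bary V x c" by blast
    \<comment> \<open>Otherwise \<open>x\<close> is the vertex \<open>c\<close>, which is then also
      a vertex of \<open>U\<close>, and \<open>u = c\<close> lies in \<open>V\<close>.\<close>
    have "\<exists>d\<in>V. d \<noteq> c \<and> 0 < bary V x d"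
    proof (rule ccontr)
      assume "\<not> ?thesis"
      then have "x = c"
        using nnV by (intro bary_single_support[OF bV c(1)]) force
      then have "c \<in> U"
        using vertex_in_hull[OF UV(1)] c(1) sub UV x(1) by blast
      then have "u = c"
        using u \<open>x = c\<close> bary_vertex[OF bU, of u c] by (auto split: if_splits)
      then show False using c(1) \<open>u \<notin> V\<close> by simp
    qed
    then obtain d where d: "d \<in> V" "d \<noteq> c" "0 < bary V x d" by blast
    have "c \<in> W" "d \<in> W"
      using c d sub UV by auto
    have uc: "u \<noteq> c" "u \<noteq> d"
      using c d \<open>u \<notin> V\<close> by auto
    have "\<not> affine_dependent {u, c, d}"
      using three_vertices_independent[OF uW \<open>c \<in> W\<close> \<open>d \<in> W\<close>] uc d by blast
    \<comment> \<open>Both planes contain \<open>u\<close>, \<open>c\<close>, \<open>d\<close>, so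
      in a basis \<open>T\<close> extending these both functionals become multiples of the fourth
      coordinate \<open>r\<close>.\<close>
    then obtain T where T: "\<not> affine_dependent T" "{u, c, d} \<subseteq> T" "affine hull T = affine hull UNIV"
      using extend_to_affine_basis[OF _ subset_UNIV] by metis
    have "aff_dim T = aff_dim (UNIV :: (real^3) set)"
      using T(3) by (metis aff_dim_affine_hull)
    then have "aff_dim T = 3"
      by simp
    then have bT: "affine_basis T" "card T = 4"
      using T(1) affine_independent_iff_card[of T] by (auto simp: affine_basis_3)
    obtain e z where ez: "T = {u, c, e, z}" "e \<notin> {u, c}" "z \<notin> {u, c, e}"
      using card_4_split[OF bT(2)] T(2) uc(1) by (metis insert_subset)
    define z' where "z' = (if d = e then z else e)"
    have Tz: "T = {u, c, d, z'}" "d \<notin> {u, c}" "z' \<notin> {u, c, d}"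
      using ez T(2) uc d by (auto simp: z'_def)
    define r where "r = (\<lambda>y. bary T y z')"
    have fr: "f \<bullet> y - f \<bullet> x = r y * (f \<bullet> z' - f \<bullet> x)" for y
      using inner_bary_diff[OF bT(1), of f y "f \<bullet> x"] fU[OF u] fV[OF c] fV[OF d(1,3)]
      unfolding sum_4[OF Tz(1) uc(1) Tz(2,3)] by (simp add: r_def)
    have ar: "a \<bullet> y - b = r y * (a \<bullet> z' - b)" for y
      using inner_bary_diff[OF bT(1), of a y b] aU[OF u] aV[OF c] aV[OF d(1,3)]
      unfolding sum_4[OF Tz(1) uc(1) Tz(2,3)] by (simp add: r_def)
    have fz: "f \<bullet> z' - f \<bullet> x \<noteq> 0"
      using inner_not_const[OF bT(1) f(1), of "f \<bullet> x"] fr by force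
    obtain y where y: "y \<in> U" "a \<bullet> y \<noteq> b"
      using inner_not_const[OF bU a(1)] by blast
    obtain y' where y': "y' \<in> V" "a \<bullet> y' \<noteq> b"
      using inner_not_const[OF bV a(1)] by blast
    \<comment> \<open>The supporting plane has \<open>y\<close> and \<open>y'\<close> weakly on one
      side, the separating plane has them strictly on opposite sides.\<close>
    have "r y * (f \<bullet> z' - f \<bullet> x) \<le> 0" "r y' * (f \<bullet> z' - f \<bullet> x) \<le> 0"
      using f(2)[OF W_sub] y(1) y'(1) sub UV fr by (metis diff_le_0_iff_le subsetD)+
    moreover have "r y * (a \<bullet> z' - b) < 0" "0 < r y' * (a \<bullet> z' - b)"
      using a(2)[of y] a(3)[of y'] y y' ar[of y] ar[of y'] by (auto simp: hull_inc)
    ultimately show False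
      using fz by (auto simp: mult_le_0_iff mult_less_0_iff zero_less_mult_iff)
  next
    case True
    obtain d where d: "d \<in> V" "a \<bullet> d \<noteq> b"
      using inner_not_const[OF bV a(1)] by blast
    let ?C = "{v \<in> V. 0 < bary V x v}"
    have Cd: "?C \<subseteq> V - {d}"
      using aV d by auto
    have notpair: "y \<notin> convex hull e" if "y \<in> interior P" "e \<in> pairs V" for y e
      using pair_hull_not_interior[of e y] that front[OF UV(2) that(2)] sub[OF UV(2)]
      by (auto simp: pairs_def)
    \<comment> \<open>With fewer supporting vertices the interior point \<open>x\<close> would lie
      on an edge of \<open>V\<close>.\<close>
    have "3 \<le> card ?C"
    proof (rule ccontr)
      assume "\<not> ?thesis"
      then obtain e where e: "?C \<subseteq> e" "e \<subseteq> V" "card e = 2"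
        using exists_subset_between[of ?C 2 V] finite_V[OF UV(2)] card_V[OF UV(2)] by auto
      then have "x \<in> convex hull e"
        using nnV by (force simp: convex_hull_bary_iff[OF bV e(2)])
      then show False
        using notpair[OF True] e by (simp add: pairs_def)
    qed
    then have "?C = V - {d}"
      using Cd finite_V[OF UV(2)] card_V[OF UV(2)] d(1) by (intro card_subset_eq card_seteq) auto
    then have pos: "0 < bary V x v" if "v \<in> V" "v \<noteq> d" for v
      using that by blast
    have "(\<Sum>v\<in>V. bary V u v * (a \<bullet> v - b)) = (\<Sum>v\<in>V. if v = d then bary V u d * (a \<bullet> d - b) else 0)"
      using pos aV by (intro sum.cong) auto
    then have "bary V u d * (a \<bullet> d - b) = 0"
      using inner_bary_diff[OF bV, of a u b] aU[OF u] d(1) finite_V[OF UV(2)] by simp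
    then have ud: "bary V u d = 0"
      using d(2) by simp
    have xd: "bary V x d = 0"
      using Cd nnV[OF d(1)] d(1) by force
    let ?J = "{j \<in> V. bary V u j < 0}" and ?r = "\<lambda>j. bary V x j / (bary V x j - bary V u j)"
    have "u \<notin> convex hull V"
      using vertex_in_hull[OF UV(2) uW] \<open>u \<notin> V\<close> by blast
    then have J: "?J \<noteq> {}" "finite ?J"
      using finite_V[OF UV(2)] by (auto simp: convex_hull_bary[OF bV] not_le)
    \<comment> \<open>Ratio test: among the coordinates that become negative on the way from
      \<open>x\<close> to \<open>u\<close>, that of \<open>j\<close> vanishes first. At that moment
      the point \<open>y\<close> is on the edge \<open>V - {d, j}\<close>.\<close>
    obtain j where j: "j \<in> ?J" "\<And>i. i \<in> ?J \<Longrightarrow> ?r j \<le> ?r i"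
      using arg_min_if_finite[OF J(2,1), of ?r] by (meson not_less)
    have jd: "j \<noteq> d"
      using j(1) ud by auto
    define t where "t = ?r j"
    have t: "0 < t" "t < 1"
      using j(1) pos[of j] jd by (auto simp: t_def divide_simps)
    define y where "y = (1 - t) *\<^sub>R x + t *\<^sub>R u"
    have bary_y: "bary V y i = bary V x i - t * (bary V x i - bary V u i)" if "i \<in> V" for i
      unfolding y_def using bary_affine[OF bV _ that, of "1 - t" t x u] by (simp add: algebra_simps)
    have "bary V y j = 0"
      using j(1) pos[of j] jd by (simp add: bary_y t_def)
    moreover have "bary V y d = 0"
      by (simp add: bary_y d xd ud)
    moreover have "0 \<le> bary V y i" if "i \<in> V" for i
    proof (cases "bary V u i < 0")
      case True
      then have "t \<le> ?r i" "0 < bary V x i - bary V u i"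
        using j(2)[of i] that nnV[OF that] by (auto simp: t_def)
      then show ?thesis
        by (simp add: bary_y[OF that] le_divide_eq)
    next
      case False
      then show ?thesis
        unfolding y_def using bary_affine[OF bV _ that, of "1 - t" t x u] nnV[OF that] t by simp
    qed
    ultimately have "y \<in> convex hull (V - {d, j})"
      by (subst convex_hull_bary_iff[OF bV]) auto
    moreover have "V - {d, j} \<in> pairs V"
      using card_V[OF UV(2)] finite_V[OF UV(2)] d(1) j(1) jd by (auto simp: pairs_def card_Diff_subset)
    moreover have "y \<in> interior P"
    proof -
      have "u - (1 - t) *\<^sub>R (u - x) \<in> interior P"
        using t by (intro mem_interior_convex_shrink[OF convex_convex_hull True W_sub[OF uW]]) auto
      then show ?thesis
        by (simp add: y_def algebra_simps)
    qed
    ultimately show False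
      using notpair by blast
  qed
qed

text \<open>By \<open>support_subset\<close> a common point has positive
  \<open>U\<close>-coordinates only at vertices shared with \<open>V\<close>.\<close>

lemma hull_Int:
  assumes front: "\<And>V e. V \<in> \<V> \<Longrightarrow> e \<in> pairs V \<Longrightarrow> centroid e \<notin> interior P"
    and UV: "U \<in> \<V>" "V \<in> \<V>"
  shows "convex hull U \<inter> convex hull V = convex hull (U \<inter> V)"
proof
  show "convex hull (U \<inter> V) \<subseteq> convex hull U \<inter> convex hull V"
    by (simp add: hull_mono)
  show "convex hull U \<inter> convex hull V \<subseteq> convex hull (U \<inter> V)"
  proof
    fix x assume x: "x \<in> convex hull U \<inter> convex hull V"
    then have nn: "\<forall>u\<in>U. 0 \<le> bary U x u"
      by (simp add: convex_hull_bary[OF basis[OF UV(1)]])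
    show "x \<in> convex hull (U \<inter> V)"
    proof (cases "U = V")
      case False
      have "bary U x u = 0" if "u \<in> U - V" for u
      proof (rule ccontr)
        assume "bary U x u \<noteq> 0"
        then have "0 < bary U x u"
          using nn that by (simp add: order_less_le)
        then have "u \<in> V"
          by (intro support_subset[where U = U and V = V and x = x]) (use front UV False x that in auto)
        then show False
          using that by simp
      qed
      then show ?thesis
        using nn by (simp add: convex_hull_bary_iff[OF basis[OF UV(1)]])
    qed (use x in simp)
  qed
qed

end

section \<open>Transfer to dissections of polytopes\<close>

lemma dissection_tetrahedral:
  assumes P: "convex_3_polytope P" and D: "dissection P \<D>"
  shows "tetrahedral_dissection (vertices P) (vertices ` \<D>)"
    and "card (vertices ` \<D>) = card \<D>"
    and "convex hull (vertices P) = P"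
    and "\<And>T. T \<in> \<D> \<Longrightarrow> convex hull (vertices T) = T"
proof -
  have "polytope P" "aff_dim P = 3"
    using P by (auto simp: convex_3_polytope_def)
  then have "finite (vertices P)"
    unfolding vertices_def using finite_polyhedron_extreme_points polytope_imp_polyhedron by blast
  show hullP: "convex hull (vertices P) = P"
    using \<open>polytope P\<close> Krein_Milman_polytope unfolding vertices_def polytope_def by metis
  have T: "affine_basis (vertices T) \<and> convex hull (vertices T) = T" if TD: "T \<in> \<D>" for T
  proof -
    obtain C where C: "\<not> affine_dependent C" "int (card C) = 3 + 1" "T = convex hull C"
      using D TD unfolding dissection_def simplex_def by force
    then have "vertices T = C"
      by (simp add: vertices_def extreme_point_of_convex_hull_affine_independent)
    then show ?thesis
      using C by (simp add: affine_basis_3)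
  qed
  then show "\<And>T. T \<in> \<D> \<Longrightarrow> convex hull (vertices T) = T"
    by blast
  then have "inj_on vertices \<D>"
    by (metis inj_onI)
  then show "card (vertices ` \<D>) = card \<D>"
    by (rule card_image)
  have "interior P \<noteq> {}"
  proof -
    have "affine hull P = UNIV"
      using \<open>aff_dim P = 3\<close> aff_dim_eq_full[of P] by simp
    then have "rel_interior P = interior P"
      by (rule rel_interior_interior)
    moreover have "P \<noteq> {}"
      using \<open>aff_dim P = 3\<close> by auto
    ultimately show ?thesis
      using \<open>polytope P\<close> by (metis polytope_imp_convex rel_interior_eq_empty)
  qed
  show "tetrahedral_dissection (vertices P) (vertices ` \<D>)"
  proof
    show "finite (vertices P)" by fact
    show "w extreme_point_of convex hull (vertices P)" if "w \<in> vertices P" for w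
      using that unfolding hullP by (simp add: vertices_def)
    show "affine_basis V" if "V \<in> vertices ` \<D>" for V
      using that T by auto
    show "V \<subseteq> vertices P" if "V \<in> vertices ` \<D>" for V
      using that D by (auto simp: dissection_def)
    show "interior (convex hull U) \<inter> interior (convex hull V) = {}"
      if UV: "U \<in> vertices ` \<D>" "V \<in> vertices ` \<D>" "U \<noteq> V" for U V
    proof -
      obtain S S' where S: "S \<in> \<D>" "S' \<in> \<D>" "U = vertices S" "V = vertices S'"
        using UV(1,2) by blast
      then have "S \<noteq> S'"
        using UV(3) by blast
      then show ?thesis
        using S T D by (simp add: dissection_def)
    qed
    show "(\<Union>V\<in>vertices ` \<D>. convex hull V) = convex hull vertices P"
      using T D by (auto simp: hullP dissection_def)
    show "interior (convex hull vertices P) \<noteq> {}"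
      unfolding hullP by fact
  qed
qed

theorem proposition3p2:
  fixes P :: "(real^3) set" and n :: nat
  assumes "convex_3_polytope P"
    and "card (vertices P) = n"
  shows "(\<forall>\<D>. mismatching_dissection P \<D> \<longrightarrow> n - 2 \<le> card \<D>) \<and>
         (\<forall>\<D>. dissection P \<D> \<longrightarrow> card \<D> \<le> (n - 2) choose 2)"
proof (intro conjI allI impI)
  fix \<D> assume D: "dissection P \<D>"
  interpret tetrahedral_dissection "vertices P" "vertices ` \<D>"
    by (rule dissection_tetrahedral[OF assms(1) D])
  show "card \<D> \<le> (n - 2) choose 2"
    using upper_bound dissection_tetrahedral(2)[OF assms(1) D] assms(2) by simp
next
  fix \<D> assume "mismatching_dissection P \<D>"
  then have D: "dissection P \<D>" and nt: "\<not> triangulation \<D>"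
    by (auto simp: mismatching_dissection_def)
  interpret tetrahedral_dissection "vertices P" "vertices ` \<D>"
    by (rule dissection_tetrahedral[OF assms(1) D])
  note hullT = dissection_tetrahedral(4)[OF assms(1) D]
  \<comment> \<open>Without an interior edge any two tetrahedra meet in the hull of their common
    vertices, a face of both, which would make the dissection a triangulation.\<close>
  have "\<exists>V\<in>vertices ` \<D>. \<exists>e\<in>pairs V. centroid e \<in> interior (convex hull vertices P)"
  proof (rule ccontr)
    assume "\<not> ?thesis"
    then have *: "convex hull U \<inter> convex hull V = convex hull (U \<inter> V)"
      if "U \<in> vertices ` \<D>" "V \<in> vertices ` \<D>" for U V
      using hull_Int that by blast
    have "(S \<inter> T) face_of S" if "S \<in> \<D>" "T \<in> \<D>" for S T
    proof -
      have "S \<inter> T = convex hull (vertices S \<inter> vertices T)"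
        using *[of "vertices S" "vertices T"] hullT that by simp
      moreover have "convex hull (vertices S \<inter> vertices T) face_of convex hull vertices S"
        using basis[of "vertices S"] that
        by (subst face_of_convex_hull_affine_independent) (auto simp: affine_basis_def)
      ultimately show ?thesis
        using hullT[OF that(1)] by simp
    qed
    then have "triangulation \<D>"
      using triangulation_dissection_iff[OF _ D] assms(1) unfolding convex_3_polytope_def by (metis Int_commute)
    then show False
      using nt by simp
  qed
  then have "card (vertices P) - 2 \<le> card (vertices ` \<D>)"
    using lower_bound by blast
  then show "n - 2 \<le> card \<D>"
    using dissection_tetrahedral(2)[OF assms(1) D] assms(2) by simp
qed

end
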